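(* Consider the tug-of-war game with parameters $X, E, Y, F, f$: $X$ is a set of states, $E$ is the edge set of a graph with vertex set $X$, $\emptyset\neq Y\subset X$ is the set of terminal states, $F:Y\to\mathbb{R}$ is the terminal payoff and $f:X\setminus Y\to\mathbb{R}$ is the running payoff. Suppose that $(X,E)$ is connected and (1) either $f=0$ everywhere or $\inf f>0$; (2) $\inf F>-\infty$; (3) $E$ is undirected. Then the game has a value, i.e. $u_{\mathrm I}(x)=u_{\mathrm{II}}(x)$ for every starting state $x\in X$.
   Context: Game play. A token starts at $x_0=x\in X$. At the $k$-th step a fair coin is tossed (tosses are independent) and the player who wins the toss moves the token to any $x_k$ adjacent to $x_{k-1}$ in $E$. The game ends the first time $x_k\in Y$, and then player I receives the payoff $F(x_k)+\sum_{i=0}^{k-1}f(x_i)$. Player I seeks to maximize, and player II to minimize, the payoff. A strategy for a player is a map from the set of partially played games (all previous moves and coin tosses) to legal moves (or to probability distributions on legal moves). For strategies $S_{\mathrm I},S_{\mathrm{II}}$, if the game terminates with probability one and the expected total payoff exists in $[-\infty,\infty]$, let $F_-(S_{\mathrm I},S_{\mathrm{II}})=F_+(S_{\mathrm I},S_{\mathrm{II}})$ be this expected payoff; otherwise let $F_-(S_{\mathrm I},S_{\mathrm{II}})=-\infty$ and $F_+(S_{\mathrm I},S_{\mathrm{II}})=+\infty$. The value for player I is $u_{\mathrm I}(x)=\sup_{S_{\mathrm I}}\inf_{S_{\mathrm{II}}}F_-(S_{\mathrm I},S_{\mathrm{II}})$ and the value for player II is $u_{\mathrm{II}}(x)=\inf_{S_{\mathrm{II}}}\sup_{S_{\mathrm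 I}}F_+(S_{\mathrm I},S_{\mathrm{II}})$, as functions of the starting state $x$ (with values in $[-\infty,\infty]$). *)

theory Defs
  imports "HOL-Probability.Probability"
begin

text \<open>
  A (partially or completely) played game consists of the starting state and the chronological
  list of rounds.  A round records the coin toss (\<^term>\<open>True\<close>: player I won it) and the state to
  which the token was then moved.
\<close>

type_synonym 'a play = "'a \<times> (bool \<times> 'a) list"

definition visited :: "'a play \<Rightarrow> 'a list" where
  "visited h = fst h # map snd (snd h)"

definition current :: "'a play \<Rightarrow> 'a" where
  "current h = last (visited h)"

definition extend_play :: "'a play \<Rightarrow> bool \<Rightarrow> 'a \<Rightarrow> 'a play" where
  "extend_play h c y = (fst h, snd h @ [(c, y)])"

inductive_set legal_plays :: "'a set \<Rightarrow> ('a \<times> 'a) set \<Rightarrow> 'a set \<Rightarrow> 'a play set"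
  for X :: "'a set" and E :: "('a \<times> 'a) set" and Y :: "'a set" where
  start: "x \<in> X \<Longrightarrow> (x, []) \<in> legal_plays X E Y"
| move: "h \<in> legal_plays X E Y \<Longrightarrow> current h \<notin> Y \<Longrightarrow> (current h, y) \<in> E
    \<Longrightarrow> extend_play h c y \<in> legal_plays X E Y"

definition connected_graph :: "'a set \<Rightarrow> ('a \<times> 'a) set \<Rightarrow> bool" where
  "connected_graph X E \<longleftrightarrow> (\<forall>x\<in>X. \<forall>y\<in>X. (x, y) \<in> E\<^sup>*)"

text \<open>
  A strategy is consulted only while the game is still running; its values elsewhere are irrelevant.
  The set of states carries no measurable structure, so a probability distribution on legal moves
  is a discrete one.  Deterministic strategies are those that only use point masses.
\<close>

type_synonym 'a strategy = "'a play \<Rightarrow> 'a pmf"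

definition random_strategies ::
    "'a set \<Rightarrow> ('a \<times> 'a) set \<Rightarrow> 'a set \<Rightarrow> 'a strategy set" where
  "random_strategies X E Y =
    {S. \<forall>h\<in>legal_plays X E Y. current h \<notin> Y \<longrightarrow> set_pmf (S h) \<subseteq> E `` {current h}}"

definition deterministic_strategies ::
    "'a set \<Rightarrow> ('a \<times> 'a) set \<Rightarrow> 'a set \<Rightarrow> 'a strategy set" where
  "deterministic_strategies X E Y =
    {\<lambda>h. return_pmf (s h) | s.
      \<forall>h\<in>legal_plays X E Y. current h \<notin> Y \<longrightarrow> (current h, s h) \<in> E}"

definition play_step ::
    "'a set \<Rightarrow> 'a strategy \<Rightarrow> 'a strategy \<Rightarrow> 'a play \<Rightarrow> 'a play pmf" where
  "play_step Y S1 S2 h =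
    (if current h \<in> Y then return_pmf h
     else bind_pmf (bernoulli_pmf (1 / 2)) (\<lambda>c.
            map_pmf (extend_play h c) (if c then S1 h else S2 h)))"

primrec play_pmf ::
    "'a set \<Rightarrow> 'a strategy \<Rightarrow> 'a strategy \<Rightarrow> 'a \<Rightarrow> nat \<Rightarrow> 'a play pmf" where
  "play_pmf Y S1 S2 x 0 = return_pmf (x, [])"
| "play_pmf Y S1 S2 x (Suc n) = bind_pmf (play_pmf Y S1 S2 x n) (play_step Y S1 S2)"

text \<open>
  The law of the completed game, as a measure on the finite plays that end in a terminal state.
  A completed play with \<open>k\<close> rounds is exactly what is observed after \<open>k\<close> steps, so its
  probability is read off from the law of the game after \<open>k\<close> steps.  The total mass is the
  probability that the game terminates.
\<close>

definition completed_law ::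
    "'a set \<Rightarrow> 'a strategy \<Rightarrow> 'a strategy \<Rightarrow> 'a \<Rightarrow> 'a play measure" where
  "completed_law Y S1 S2 x =
    density (count_space {h. current h \<in> Y})
      (\<lambda>h. ennreal (pmf (play_pmf Y S1 S2 x (length (snd h))) h))"

definition terminates_almost_surely ::
    "'a set \<Rightarrow> 'a strategy \<Rightarrow> 'a strategy \<Rightarrow> 'a \<Rightarrow> bool" where
  "terminates_almost_surely Y S1 S2 x \<longleftrightarrow>
    emeasure (completed_law Y S1 S2 x) (space (completed_law Y S1 S2 x)) = 1"

definition total_payoff :: "('a \<Rightarrow> real) \<Rightarrow> ('a \<Rightarrow> real) \<Rightarrow> 'a play \<Rightarrow> real" where
  "total_payoff F f h = F (current h) + (\<Sum>z\<leftarrow>butlast (visited h). f z)"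

text \<open>
  Expectations in \<open>[-\<infinity>, \<infinity>]\<close>: they exist unless the positive and the negative part
  both have infinite integral (\<^const>\<open>ennreal\<close> truncates negative reals to 0).
\<close>

definition expectation_exists :: "'b measure \<Rightarrow> ('b \<Rightarrow> real) \<Rightarrow> bool" where
  "expectation_exists M g \<longleftrightarrow>
    (\<integral>\<^sup>+ w. ennreal (g w) \<partial>M) < \<infinity> \<or> (\<integral>\<^sup>+ w. ennreal (- g w) \<partial>M) < \<infinity>"

definition extended_expectation :: "'b measure \<Rightarrow> ('b \<Rightarrow> real) \<Rightarrow> ereal" where
  "extended_expectation M g =
    enn2ereal (\<integral>\<^sup>+ w. ennreal (g w) \<partial>M) - enn2ereal (\<integral>\<^sup>+ w. ennreal (- g w) \<partial>M)"

definition payoff_defined ::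
    "'a set \<Rightarrow> ('a \<Rightarrow> real) \<Rightarrow> ('a \<Rightarrow> real) \<Rightarrow> 'a \<Rightarrow> 'a strategy \<Rightarrow> 'a strategy \<Rightarrow> bool" where
  "payoff_defined Y F f x S1 S2 \<longleftrightarrow>
    terminates_almost_surely Y S1 S2 x \<and>
    expectation_exists (completed_law Y S1 S2 x) (total_payoff F f)"

definition F_minus ::
    "'a set \<Rightarrow> ('a \<Rightarrow> real) \<Rightarrow> ('a \<Rightarrow> real) \<Rightarrow> 'a \<Rightarrow> 'a strategy \<Rightarrow> 'a strategy \<Rightarrow> ereal" where
  "F_minus Y F f x S1 S2 =
    (if payoff_defined Y F f x S1 S2
     then extended_expectation (completed_law Y S1 S2 x) (total_payoff F f) else - \<infinity>)"

definition F_plus ::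
    "'a set \<Rightarrow> ('a \<Rightarrow> real) \<Rightarrow> ('a \<Rightarrow> real) \<Rightarrow> 'a \<Rightarrow> 'a strategy \<Rightarrow> 'a strategy \<Rightarrow> ereal" where
  "F_plus Y F f x S1 S2 =
    (if payoff_defined Y F f x S1 S2
     then extended_expectation (completed_law Y S1 S2 x) (total_payoff F f) else \<infinity>)"

text \<open>
  The values are relative to the set \<open>\<Sigma>\<close> of strategies that both players may use
  (all of \<^const>\<open>random_strategies\<close>, or only \<^const>\<open>deterministic_strategies\<close>).
\<close>

definition value_I ::
    "'a strategy set \<Rightarrow> 'a set \<Rightarrow> ('a \<Rightarrow> real) \<Rightarrow> ('a \<Rightarrow> real) \<Rightarrow> 'a \<Rightarrow> ereal" where
  "value_I \<Sigma> Y F f x = (SUP S1\<in>\<Sigma>. INF S2\<in>\<Sigma>. F_minus Y F f x S1 S2)"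

definition value_II ::
    "'a strategy set \<Rightarrow> 'a set \<Rightarrow> ('a \<Rightarrow> real) \<Rightarrow> ('a \<Rightarrow> real) \<Rightarrow> 'a \<Rightarrow> ereal" where
  "value_II \<Sigma> Y F f x = (INF S2\<in>\<Sigma>. SUP S1\<in>\<Sigma>. F_plus Y F f x S1 S2)"

end

theory Submission imports Defs begin

text \<open>
  After shifting payoffs by a bound \<open>b\<close>, let \<open>u\<close> be the least \<open>[0, \<infinity>]\<close>-valued function that equals
  \<open>F + b\<close> on \<open>Y\<close> and satisfies \<open>u = f + (sup u + inf u) / 2\<close> over the neighbours elsewhere.

  The amount that player I can guarantee is a supersolution of this equation, because near-optimal
  strategies at the neighbours can be glued into one strategy; so it is at least \<open>u\<close>.  Termination
  costs player I nothing: when he moves towards \<open>Y\<close>, the distance to \<open>Y\<close> is dominated by a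
  simple random walk, since edges are undirected.

  Conversely let player II move greedily for \<open>u\<close>.  Then \<open>u\<close> plus the running payoff is a
  supermartingale (up to \<open>\<epsilon>\<close>), and a running payoff bounded away from zero forces termination.
  If \<open>f = 0\<close>, player II instead moves greedily for a modification of \<open>u\<close>, still a supersolution,
  whose variation at every state is at least some \<open>d > 0\<close>; a nonnegative supermartingale with steps
  of size at least \<open>d\<close> cannot go on forever.
\<close>

section \<open>Plays and the law of the completed game\<close>

text \<open>Unlike \<open>play_pmf\<close>, this starts at an arbitrary play and splits off the
  first step, so that inductions over the number of steps can vary the history.\<close>

primrec run :: "'a set \<Rightarrow> 'a strategy \<Rightarrow> 'a strategy \<Rightarrow> nat \<Rightarrow> 'a play \<Rightarrow> 'a play pmf" where
  "run Y S1 S2 0 = return_pmf"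
| "run Y S1 S2 (Suc n) = (\<lambda>h. bind_pmf (play_step Y S1 S2 h) (run Y S1 S2 n))"

lemma run_Suc_last: "run Y S1 S2 (Suc n) h = bind_pmf (run Y S1 S2 n h) (play_step Y S1 S2)"
proof (induction n arbitrary: h)
  case 0
  then show ?case by (simp add: bind_return_pmf bind_return_pmf')
next
  case (Suc n)
  have "run Y S1 S2 (Suc (Suc n)) h = bind_pmf (play_step Y S1 S2 h) (run Y S1 S2 (Suc n))"
    by simp
  also have "\<dots> = bind_pmf (play_step Y S1 S2 h)
      (\<lambda>h'. bind_pmf (run Y S1 S2 n h') (play_step Y S1 S2))"
    by (intro bind_pmf_cong refl Suc)
  also have "\<dots> = bind_pmf (run Y S1 S2 (Suc n) h) (play_step Y S1 S2)"
    by (simp add: bind_assoc_pmf)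
  finally show ?case .
qed

lemma play_pmf_eq_run: "play_pmf Y S1 S2 x n = run Y S1 S2 n (x, [])"
proof (induction n)
  case 0
  then show ?case by simp
next
  case (Suc n)
  then show ?case by (simp only: play_pmf.simps run_Suc_last)
qed

lemma play_step_terminal: "current h \<in> Y \<Longrightarrow> play_step Y S1 S2 h = return_pmf h"
  by (simp add: play_step_def)

lemma set_play_stepE:
  assumes "h' \<in> set_pmf (play_step Y S1 S2 h)" "current h \<notin> Y"
  obtains c y where "h' = extend_play h c y" "y \<in> set_pmf (if c then S1 h else S2 h)"
proof -
  have "h' \<in> (\<Union>c. extend_play h c ` set_pmf (if c then S1 h else S2 h))"
    using assms by (simp only: play_step_def if_False set_bind_pmf set_map_pmf) simp
  then show thesis by (elim UN_E imageE) (rule that)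
qed

lemma nn_integral_play_step:
  assumes "current h \<notin> Y"
  shows "(\<integral>\<^sup>+h'. k h' \<partial>play_step Y S1 S2 h) =
    ((\<integral>\<^sup>+y. k (extend_play h True y) \<partial>S1 h) + (\<integral>\<^sup>+y. k (extend_play h False y) \<partial>S2 h)) / 2"
proof -
  have "ennreal (1/2) = 1 / 2"
    by (metis divide_ennreal ennreal_1 ennreal_numeral zero_le_numeral zero_less_numeral zero_le_one)
  then show ?thesis
    using assms
    by (simp add: play_step_def nn_integral_bind_pmf nn_integral_map_pmf divide_ennreal_def
      distrib_right)
qed

lemma nn_integral_pmf_le_const:
  "(\<And>y. y \<in> set_pmf p \<Longrightarrow> k y \<le> (A::ennreal)) \<Longrightarrow> (\<integral>\<^sup>+y. k y \<partial>measure_pmf p) \<le> A"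
  by (rule order_trans[OF nn_integral_mono_AE[where v = "\<lambda>_. A"]]) (auto simp: AE_measure_pmf_iff)

lemma nn_integral_pmf_ge_const:
  "(\<And>y. y \<in> set_pmf p \<Longrightarrow> (A::ennreal) \<le> k y) \<Longrightarrow> A \<le> (\<integral>\<^sup>+y. k y \<partial>measure_pmf p)"
  by (rule order_trans[OF _ nn_integral_mono_AE[where u = "\<lambda>_. A"]]) (auto simp: AE_measure_pmf_iff)

text \<open>Expectation of \<open>g\<close> at the end of the game continued from \<open>h\<close>,
  where unfinished plays contribute 0; for \<open>g = 1\<close> it is the probability of
  termination. Finished plays stay put, so the truncated integrals increase in
  \<open>n\<close>.\<close>

definition terminal_integral ::
    "'a set \<Rightarrow> 'a strategy \<Rightarrow> 'a strategy \<Rightarrow> ('a play \<Rightarrow> ennreal) \<Rightarrow> 'a play \<Rightarrow> ennreal" where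
  "terminal_integral Y S1 S2 g h =
    (SUP n. \<integral>\<^sup>+h'. g h' * indicator {h. current h \<in> Y} h' \<partial>run Y S1 S2 n h)"

lemma terminal_integral_incseq:
  "incseq (\<lambda>n. \<integral>\<^sup>+h'. g h' * indicator {h. current h \<in> Y} h' \<partial>run Y S1 S2 n h)"
proof (rule incseq_SucI)
  fix n
  have "g h' * indicator {h. current h \<in> Y} h'
      \<le> (\<integral>\<^sup>+k. g k * indicator {h. current h \<in> Y} k \<partial>play_step Y S1 S2 h')" for h'
    by (cases "current h' \<in> Y") (auto simp: play_step_terminal)
  then show "(\<integral>\<^sup>+h'. g h' * indicator {h. current h \<in> Y} h' \<partial>run Y S1 S2 n h)
      \<le> (\<integral>\<^sup>+h'. g h' * indicator {h. current h \<in> Y} h' \<partial>run Y S1 S2 (Suc n) h)"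
    by (simp only: run_Suc_last nn_integral_bind_pmf) (rule nn_integral_mono)
qed

text \<open>Starting the supremum at one step instead of none leaves it unchanged, and monotone
  convergence moves it inside the first step.\<close>

lemma terminal_integral_play_step:
  "terminal_integral Y S1 S2 g h = (\<integral>\<^sup>+h'. terminal_integral Y S1 S2 g h' \<partial>play_step Y S1 S2 h)"
proof -
  let ?a = "\<lambda>n h. \<integral>\<^sup>+h'. g h' * indicator {h. current h \<in> Y} h' \<partial>run Y S1 S2 n h"
  have "terminal_integral Y S1 S2 g h = (SUP n. ?a (Suc n) h)"
    unfolding terminal_integral_def
  proof (intro antisym SUP_least)
    fix n
    show "?a n h \<le> (SUP n. ?a (Suc n) h)"
      by (rule SUP_upper2[of n UNIV _ "\<lambda>n. ?a (Suc n) h"])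
        (rule UNIV_I, rule incseq_SucD[OF terminal_integral_incseq])
    show "?a (Suc n) h \<le> (SUP n. ?a n h)"
      by (rule SUP_upper[of "Suc n" UNIV "\<lambda>n. ?a n h"]) (rule UNIV_I)
  qed
  also have "\<dots> = (SUP n. \<integral>\<^sup>+h'. ?a n h' \<partial>play_step Y S1 S2 h)"
    by (simp add: nn_integral_bind_pmf)
  also have "\<dots> = (\<integral>\<^sup>+h'. (SUP n. ?a n h') \<partial>play_step Y S1 S2 h)"
    by (rule nn_integral_monotone_convergence_SUP[symmetric])
      (auto simp: incseq_def le_fun_def intro!: monoD[OF terminal_integral_incseq])
  finally show ?thesis by (simp add: terminal_integral_def)
qed

lemma run_terminal: "current h \<in> Y \<Longrightarrow> run Y S1 S2 n h = return_pmf h"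
  by (induction n) (auto simp: play_step_terminal bind_return_pmf)

lemma terminal_integral_terminal: "current h \<in> Y \<Longrightarrow> terminal_integral Y S1 S2 g h = g h"
  by (simp add: terminal_integral_def run_terminal)

text \<open>From \<open>h\<close> on, only continuations of \<open>h\<close> are consulted. This
  makes it possible to glue strategies.\<close>

lemma terminal_integral_cong_strategy:
  assumes "\<And>l. S1 (fst h, snd h @ l) = S1' (fst h, snd h @ l)"
    and "\<And>l. S2 (fst h, snd h @ l) = S2' (fst h, snd h @ l)"
  shows "terminal_integral Y S1 S2 g h = terminal_integral Y S1' S2' g h"
proof -
  have "run Y S1 S2 n h = run Y S1' S2' n h" for n
    using assms
  proof (induction n arbitrary: h)
    case 0
    then show ?case by simp
  next
    case (Suc n)
    show ?case
    proof (cases "current h \<in> Y")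
      case True
      then show ?thesis by (simp only: run_terminal)
    next
      case False
      have *: "play_step Y S1 S2 h = play_step Y S1' S2' h"
        using Suc.prems[of "[]"] by (simp add: play_step_def cong: if_cong)
      have "run Y S1 S2 n h' = run Y S1' S2' n h'" if h': "h' \<in> set_pmf (play_step Y S1' S2' h)" for h'
      proof -
        from h' False obtain c y where "h' = extend_play h c y" by (rule set_play_stepE)
        then show ?thesis
          using Suc.prems by (intro Suc.IH) (simp_all add: extend_play_def)
      qed
      then show ?thesis by (simp add: * cong: bind_pmf_cong)
    qed
  qed
  then show ?thesis by (simp add: terminal_integral_def)
qed

lemma length_play_pmf:
  "h \<in> set_pmf (play_pmf Y S1 S2 x n) \<Longrightarrow>
    length (snd h) \<le> n \<and> (current h \<notin> Y \<longrightarrow> length (snd h) = n)"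
proof (induction n arbitrary: h)
  case 0
  then show ?case by simp
next
  case (Suc n)
  then obtain h' where h': "h' \<in> set_pmf (play_pmf Y S1 S2 x n)" "h \<in> set_pmf (play_step Y S1 S2 h')"
    by auto
  show ?case
  proof (cases "current h' \<in> Y")
    case True
    then show ?thesis using Suc.IH[OF h'(1)] h'(2) by (auto simp: play_step_terminal)
  next
    case False
    with h'(2) obtain c y where "h = extend_play h' c y" by (rule set_play_stepE)
    then show ?thesis using Suc.IH[OF h'(1)] False by (simp add: extend_play_def)
  qed
qed

text \<open>A finished play with \<open>k\<close> rounds first appears at step \<open>k\<close> and
  then keeps its probability: plays that are still running by then are too long to turn into
  it.\<close>

lemma pmf_play_pmf_terminal:
  assumes "current h \<in> Y"
  shows "pmf (play_pmf Y S1 S2 x n) h =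
    (if length (snd h) \<le> n then pmf (play_pmf Y S1 S2 x (length (snd h))) h else 0)"
proof (cases "length (snd h) \<le> n")
  case False
  then have "h \<notin> set_pmf (play_pmf Y S1 S2 x n)" using length_play_pmf[of h Y S1 S2 x n] by auto
  then show ?thesis using False by (simp add: set_pmf_iff)
next
  case True
  then have "pmf (play_pmf Y S1 S2 x n) h = pmf (play_pmf Y S1 S2 x (length (snd h))) h"
  proof (induction rule: dec_induct)
    case base
    then show ?case by simp
  next
    case (step n)
    have "pmf (play_step Y S1 S2 h') h = indicator {h} h'"
      if h': "h' \<in> set_pmf (play_pmf Y S1 S2 x n)" for h'
    proof (cases "current h' \<in> Y")
      case True
      then show ?thesis by (auto simp: play_step_terminal indicator_def)
    next
      case False
      then have "length (snd h') = n" using length_play_pmf[OF h'] by simp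
      then have "h \<notin> set_pmf (play_step Y S1 S2 h')"
        using False step by (auto simp: extend_play_def elim!: set_play_stepE)
      then show ?thesis using False assms by (auto simp: set_pmf_iff indicator_def)
    qed
    then have "pmf (play_pmf Y S1 S2 x (Suc n)) h =
        measure_pmf.expectation (play_pmf Y S1 S2 x n) (indicator {h})"
      unfolding play_pmf.simps pmf_bind
      by (intro integral_cong_AE) (auto simp: AE_measure_pmf_iff)
    also have "\<dots> = pmf (play_pmf Y S1 S2 x n) h"
      by (simp add: measure_pmf_single)
    finally show ?case using step by simp
  qed
  then show ?thesis using True by simp
qed

text \<open>Observing the game after \<open>n\<close> steps amounts to restricting the completed law
  to plays with at most \<open>n\<close> rounds; monotone convergence removes the
  restriction.\<close>

lemma nn_integral_completed_law:
  "(\<integral>\<^sup>+h. g h \<partial>completed_law Y S1 S2 x) = terminal_integral Y S1 S2 g (x, [])"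
proof -
  let ?T = "{h. current h \<in> Y}"
  let ?p = "\<lambda>h. ennreal (pmf (play_pmf Y S1 S2 x (length (snd h))) h)"
  have *: "(\<integral>\<^sup>+h'. g h' * indicator ?T h' \<partial>run Y S1 S2 n (x, []))
      = (\<integral>\<^sup>+h. ?p h * g h * indicator {h. length (snd h) \<le> n} h \<partial>count_space ?T)" for n
  proof -
    have "(\<integral>\<^sup>+h'. g h' * indicator ?T h' \<partial>run Y S1 S2 n (x, []))
      = (\<integral>\<^sup>+h. ennreal (pmf (play_pmf Y S1 S2 x n) h) * g h * indicator ?T h \<partial>count_space UNIV)"
      by (simp add: nn_integral_measure_pmf play_pmf_eq_run mult.assoc)
    also have "\<dots> = (\<integral>\<^sup>+h. ennreal (pmf (play_pmf Y S1 S2 x n) h) * g h \<partial>count_space ?T)"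
      by (simp add: nn_integral_count_space_indicator)
    also have "\<dots> = (\<integral>\<^sup>+h. ?p h * g h * indicator {h. length (snd h) \<le> n} h \<partial>count_space ?T)"
      by (rule nn_integral_cong) (auto simp: pmf_play_pmf_terminal[of _ Y S1 S2 x n])
    finally show ?thesis .
  qed
  have sup: "(SUP n. c * indicator {h. length (snd h) \<le> n} h) = c" for c :: ennreal and h :: "'a play"
  proof (rule antisym)
    show "c \<le> (SUP n. c * indicator {h. length (snd h) \<le> n} h)"
      by (rule SUP_upper2[of "length (snd h)"]) auto
  qed (auto intro!: SUP_least simp: indicator_def)
  have "(\<integral>\<^sup>+h. g h \<partial>completed_law Y S1 S2 x) = (\<integral>\<^sup>+h. ?p h * g h \<partial>count_space ?T)"
    unfolding completed_law_def by (subst nn_integral_density) auto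
  also have "\<dots> = (\<integral>\<^sup>+h. (SUP n. ?p h * g h * indicator {h. length (snd h) \<le> n} h) \<partial>count_space ?T)"
    by (simp only: sup)
  also have "\<dots> = (SUP n. \<integral>\<^sup>+h. ?p h * g h * indicator {h. length (snd h) \<le> n} h \<partial>count_space ?T)"
    by (rule nn_integral_monotone_convergence_SUP)
      (auto simp: incseq_def le_fun_def indicator_def)
  finally show ?thesis by (simp only: terminal_integral_def *)
qed

lemma terminates_almost_surely_iff:
  "terminates_almost_surely Y S1 S2 x \<longleftrightarrow> terminal_integral Y S1 S2 (\<lambda>_. 1) (x, []) = 1"
  by (simp add: terminates_almost_surely_def nn_integral_completed_law[symmetric])

text \<open>A bound from below makes the negative part integrable, so an expectation in the extended
  reals reduces to the nonnegative integral of \<open>g + b\<close>.\<close>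

lemma extended_expectation_shift:
  assumes mass: "emeasure N (space N) = 1" and g: "g \<in> borel_measurable N"
    and lower: "AE w in N. g w \<ge> - b" and b: "b \<ge> 0"
  shows "expectation_exists N g"
    and "extended_expectation N g = enn2ereal (\<integral>\<^sup>+w. ennreal (g w + b) \<partial>N) - ereal b"
proof -
  let ?P = "\<integral>\<^sup>+w. ennreal (g w) \<partial>N" and ?M = "\<integral>\<^sup>+w. ennreal (- g w) \<partial>N"
    and ?S = "\<integral>\<^sup>+w. ennreal (g w + b) \<partial>N"
  have "?M \<le> (\<integral>\<^sup>+w. ennreal b \<partial>N)"
    using lower by (intro nn_integral_mono_AE) (auto intro!: ennreal_leI)
  then have M: "?M \<le> ennreal b"
    by (simp add: mass)
  then have Mfin: "?M < \<infinity>"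
    using le_less_trans[OF M ennreal_less_top] by simp
  then show "expectation_exists N g"
    by (simp add: expectation_exists_def)
  \<comment> \<open>Pointwise, \<open>g + b\<close> plus the negative part of \<open>g\<close> is
    the positive part of \<open>g\<close> plus \<open>b\<close>; an equation of sums avoids the
    truncated subtraction of \<open>ennreal\<close>.\<close>
  have "?S + ?M = (\<integral>\<^sup>+w. ennreal (g w + b) + ennreal (- g w) \<partial>N)"
    using g by (simp add: nn_integral_add)
  also have "\<dots> = (\<integral>\<^sup>+w. ennreal (g w) + ennreal b \<partial>N)"
  proof (rule nn_integral_cong_AE, use lower in eventually_elim)
    fix w assume "- b \<le> g w"
    then show "ennreal (g w + b) + ennreal (- g w) = ennreal (g w) + ennreal b"
      using b by (cases "g w \<ge> 0") (simp_all add: ennreal_neg flip: ennreal_plus)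
  qed
  also have "\<dots> = ?P + ennreal b"
    using g by (simp add: nn_integral_add mass)
  finally have eq: "?S + ?M = ?P + ennreal b" .
  obtain m where m: "?M = ennreal m" "m \<ge> 0"
    using Mfin by (cases ?M) auto
  show "extended_expectation N g = enn2ereal ?S - ereal b"
  proof (cases "?S")
    case (real s)
    with eq m have "?P + ennreal b = ennreal (s + m)" by simp
    then obtain p where p: "?P = ennreal p" "p \<ge> 0"
      by (cases ?P) auto
    with \<open>?P + ennreal b = ennreal (s + m)\<close> have "p + b = s + m"
      using b real m by (metis add_nonneg_nonneg ennreal_inj ennreal_plus)
    then show ?thesis
      using p real m by (simp add: extended_expectation_def)
  next
    case top
    with eq have "?P + ennreal b = top" by simp
    then have "?P = top" by (simp add: ennreal_add_eq_top)
    then show ?thesis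
      using top m by (simp add: extended_expectation_def)
  qed
qed

section \<open>Survival probabilities and almost sure termination\<close>

definition run_survival :: "'a set \<Rightarrow> 'a strategy \<Rightarrow> 'a strategy \<Rightarrow> nat \<Rightarrow> 'a play \<Rightarrow> ennreal" where
  "run_survival Y S1 S2 n h = emeasure (run Y S1 S2 n h) {h. current h \<notin> Y}"

lemma run_survival_terminal: "current h \<in> Y \<Longrightarrow> run_survival Y S1 S2 n h = 0"
  by (simp add: run_survival_def run_terminal indicator_def)

lemma run_survival_Suc:
  "run_survival Y S1 S2 (Suc n) h = (\<integral>\<^sup>+h'. run_survival Y S1 S2 n h' \<partial>play_step Y S1 S2 h)"
  by (simp add: run_survival_def emeasure_bind_pmf)

lemma run_survival_le_1: "run_survival Y S1 S2 n h \<le> 1"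
  by (simp add: run_survival_def measure_pmf.emeasure_le_1)

lemma terminates_if_survival_tendsto_0:
  assumes "\<And>e. e > 0 \<Longrightarrow> \<exists>n. run_survival Y S1 S2 n h \<le> ennreal e"
  shows "terminal_integral Y S1 S2 (\<lambda>_. 1) h = 1"
proof -
  let ?a = "\<lambda>n. emeasure (run Y S1 S2 n h) {h. current h \<in> Y}"
  have sum: "?a n + run_survival Y S1 S2 n h = 1" for n
  proof -
    have "?a n + run_survival Y S1 S2 n h =
        emeasure (run Y S1 S2 n h) ({h. current h \<in> Y} \<union> {h. current h \<notin> Y})"
      unfolding run_survival_def by (rule plus_emeasure) auto
    also have "{h. current h \<in> Y} \<union> {h. current h \<notin> Y} = (UNIV :: 'a play set)" by auto
    finally show ?thesis by simp
  qed
  have J: "terminal_integral Y S1 S2 (\<lambda>_. 1) h = (SUP n. ?a n)"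
    by (simp add: terminal_integral_def)
  show ?thesis
    unfolding J
  proof (rule antisym)
    show "(SUP n. ?a n) \<le> 1"
      by (intro SUP_least) (simp add: measure_pmf.emeasure_le_1)
    show "1 \<le> (SUP n. ?a n)"
    proof (rule ennreal_le_epsilon)
      fix e :: real assume "e > 0"
      with assms obtain n where n: "run_survival Y S1 S2 n h \<le> ennreal e" by blast
      have "1 = ?a n + run_survival Y S1 S2 n h" by (simp only: sum)
      also have "\<dots> \<le> (SUP n. ?a n) + ennreal e"
        by (intro add_mono SUP_upper n UNIV_I)
      finally show "1 \<le> (SUP n. ?a n) + ennreal e" .
    qed
  qed
qed

text \<open>The coin outcome \<open>p\<close> is the one with bound \<open>A\<close>; leaving it
  free lets the same estimate serve either player. Randomised moves do no harm, since the bounds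
  hold for every possible move.\<close>

lemma nn_integral_play_step_le:
  assumes "current h \<notin> Y"
    and bound: "\<And>c y. y \<in> set_pmf (if c then S1 h else S2 h) \<Longrightarrow>
      k (extend_play h c y) \<le> (if c = p then A else B)"
  shows "(\<integral>\<^sup>+h'. k h' \<partial>play_step Y S1 S2 h) \<le> (A + B) / 2"
proof -
  have "(\<integral>\<^sup>+y. k (extend_play h True y) \<partial>S1 h) \<le> (if p then A else B)"
    using bound[of _ True] by (intro nn_integral_pmf_le_const) (auto split: if_splits)
  moreover have "(\<integral>\<^sup>+y. k (extend_play h False y) \<partial>S2 h) \<le> (if p then B else A)"
    using bound[of _ False] by (intro nn_integral_pmf_le_const) (auto split: if_splits)
  ultimately have "(\<integral>\<^sup>+y. k (extend_play h True y) \<partial>S1 h) + (\<integral>\<^sup>+y. k (extend_play h False y) \<partial>S2 h)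
      \<le> (if p then A else B) + (if p then B else A)"
    by (rule add_mono)
  also have "\<dots> = A + B" by (simp add: add.commute)
  finally show ?thesis
    unfolding nn_integral_play_step[OF assms(1)] by (rule divide_right_mono_ennreal)
qed

section \<open>Games controlled by a potential\<close>

text \<open>Invariance of \<open>H\<close> under play, so that estimates have to hold on
  \<open>H\<close> only, for example on plays within the states of finite value.\<close>

definition steps_within :: "'a set \<Rightarrow> 'a strategy \<Rightarrow> 'a strategy \<Rightarrow> 'a play set \<Rightarrow> bool" where
  "steps_within Y S1 S2 H \<longleftrightarrow> (\<forall>h\<in>H. current h \<notin> Y \<longrightarrow>
    (\<forall>c. \<forall>y\<in>set_pmf (if c then S1 h else S2 h). extend_play h c y \<in> H))"

text \<open>
  This makes \<open>M\<close> a supermartingale; with \<open>a\<close> bounded away from zero it forces termination.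
\<close>

definition controlled ::
  "'a set \<Rightarrow> 'a strategy \<Rightarrow> 'a strategy \<Rightarrow> 'a play set \<Rightarrow> ('a play \<Rightarrow> real) \<Rightarrow> ('a play \<Rightarrow> real) \<Rightarrow> bool" where
  "controlled Y S1 S2 H M a \<longleftrightarrow> (\<forall>h\<in>H. 0 \<le> M h) \<and>
    (\<forall>h\<in>H. current h \<notin> Y \<longrightarrow>
      (\<exists>p. \<forall>c. \<forall>y\<in>set_pmf (if c then S1 h else S2 h).
        M (extend_play h c y) \<le> (if c = p then M h + a h else M h - a h)))"

text \<open>The bounds \<open>M h + a h\<close> and \<open>M h - a h\<close> average to
  \<open>M h\<close>, so the expectation of \<open>M\<close> cannot grow in any step.\<close>

lemma controlled_run_le:
  assumes H: "steps_within Y S1 S2 H" and M: "controlled Y S1 S2 H M a" and h: "h \<in> H"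
  shows "(\<integral>\<^sup>+h'. ennreal (M h') \<partial>run Y S1 S2 n h) \<le> ennreal (M h)"
  using h
proof (induction n arbitrary: h)
  case 0
  then show ?case by simp
next
  case (Suc n)
  show ?case
  proof (cases "current h \<in> Y")
    case True
    then show ?thesis by (simp only: run_terminal) simp
  next
    case False
    obtain p where p: "\<And>c y. y \<in> set_pmf (if c then S1 h else S2 h) \<Longrightarrow>
        M (extend_play h c y) \<le> (if c = p then M h + a h else M h - a h)"
      using M Suc.prems False unfolding controlled_def by meson
    have ext: "extend_play h c y \<in> H" if "y \<in> set_pmf (if c then S1 h else S2 h)" for c y
      using H Suc.prems False that unfolding steps_within_def by blast
    \<comment> \<open>Each coin outcome allows some move, after which \<open>M\<close> is
      nonnegative; so both bounds are nonnegative and their sum in \<open>ennreal\<close> is the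
      real one.\<close>
    have nonneg: "0 \<le> M h + a h" "0 \<le> M h - a h"
    proof -
      have "0 \<le> (if c = p then M h + a h else M h - a h)" for c
      proof -
        obtain y where y: "y \<in> set_pmf (if c then S1 h else S2 h)"
          by (metis ex_in_conv set_pmf_not_empty)
        have "0 \<le> M (extend_play h c y)"
          using M ext[OF y] unfolding controlled_def by blast
        then show ?thesis using p[OF y] by linarith
      qed
      from this[of p] this[of "\<not> p"] show "0 \<le> M h + a h" "0 \<le> M h - a h" by auto
    qed
    have "(\<integral>\<^sup>+h'. (\<integral>\<^sup>+h''. ennreal (M h'') \<partial>run Y S1 S2 n h') \<partial>play_step Y S1 S2 h)
        \<le> (ennreal (M h + a h) + ennreal (M h - a h)) / 2"
    proof (rule nn_integral_play_step_le[OF False, where p = p])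
      fix c y assume y: "y \<in> set_pmf (if c then S1 h else S2 h)"
      have "(\<integral>\<^sup>+h''. ennreal (M h'') \<partial>run Y S1 S2 n (extend_play h c y)) \<le> ennreal (M (extend_play h c y))"
        by (rule Suc.IH[OF ext[OF y]])
      also have "\<dots> \<le> (if c = p then ennreal (M h + a h) else ennreal (M h - a h))"
        using p[OF y] by (auto intro: ennreal_leI)
      finally show "(\<integral>\<^sup>+h''. ennreal (M h'') \<partial>run Y S1 S2 n (extend_play h c y))
          \<le> (if c = p then ennreal (M h + a h) else ennreal (M h - a h))" .
    qed
    also have "\<dots> = ennreal (M h)"
      using nonneg by (simp add: divide_ennreal flip: ennreal_plus ennreal_numeral)
    finally show ?thesis by (simp add: nn_integral_bind_pmf)
  qed
qed

lemma run_within: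
  assumes "steps_within Y S1 S2 H" "h \<in> H" "h' \<in> set_pmf (run Y S1 S2 n h)"
  shows "h' \<in> H"
  using assms(2,3)
proof (induction n arbitrary: h)
  case 0
  then show ?case by simp
next
  case (Suc n)
  from Suc.prems(2) obtain k where k: "k \<in> set_pmf (play_step Y S1 S2 h)" "h' \<in> set_pmf (run Y S1 S2 n k)"
    by auto
  have "k \<in> H"
  proof (cases "current h \<in> Y")
    case True
    then show ?thesis using k Suc.prems by (simp add: play_step_terminal)
  next
    case False
    with k(1) obtain c y where "k = extend_play h c y" "y \<in> set_pmf (if c then S1 h else S2 h)"
      by (rule set_play_stepE)
    then show ?thesis using assms(1) Suc.prems(1) False unfolding steps_within_def by blast
  qed
  then show ?case using Suc.IH k(2) by blast
qed

lemma controlled_terminal_integral_le: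
  assumes H: "steps_within Y S1 S2 H" and M: "controlled Y S1 S2 H M a" and h: "h \<in> H"
    and g: "\<And>h. h \<in> H \<Longrightarrow> current h \<in> Y \<Longrightarrow> g h \<le> ennreal (M h)"
  shows "terminal_integral Y S1 S2 g h \<le> ennreal (M h)"
  unfolding terminal_integral_def
proof (rule SUP_least)
  fix n
  have "(\<integral>\<^sup>+h'. g h' * indicator {h. current h \<in> Y} h' \<partial>run Y S1 S2 n h)
      \<le> (\<integral>\<^sup>+h'. ennreal (M h') \<partial>run Y S1 S2 n h)"
    using g run_within[OF H h]
    by (intro nn_integral_mono_AE) (auto simp: AE_measure_pmf_iff indicator_def)
  also have "\<dots> \<le> ennreal (M h)" by (rule controlled_run_le[OF H M h])
  finally show "(\<integral>\<^sup>+h'. g h' * indicator {h. current h \<in> Y} h' \<partial>run Y S1 S2 n h) \<le> ennreal (M h)" .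
qed

text \<open>
  The concave function \<open>t / K + t (4K - t) / K\<^sup>3\<close> of a potential with jumps of size at
  least \<open>d\<close> drops by \<open>d\<^sup>2 / K\<^sup>3\<close> on average, as long as the potential is below \<open>K\<close>; an
  upward jump from there ends below \<open>2K\<close>, because the matching downward jump stays nonnegative.
\<close>

lemma controlled_survival_le:
  fixes d K :: real
  assumes H: "steps_within Y S1 S2 H" and M: "controlled Y S1 S2 H M a"
    and d: "d > 0" "\<And>h. h \<in> H \<Longrightarrow> current h \<notin> Y \<Longrightarrow> d \<le> a h" and K: "K \<ge> 1"
    and h: "h \<in> H" "M h \<le> 2 * K"
  shows "run_survival Y S1 S2 n h \<le>
    ennreal (M h / K + M h * (4 * K - M h) / K ^ 3 + max 0 (1 - real n * (d\<^sup>2 / K ^ 3)))"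
  using h
proof (induction n arbitrary: h)
  case 0
  have "0 \<le> M h" using M 0 unfolding controlled_def by blast
  then have "1 \<le> M h / K + M h * (4 * K - M h) / K ^ 3 + max 0 (1 - real 0 * (d\<^sup>2 / K ^ 3))"
    using K 0 by simp
  then have "1 \<le> ennreal (M h / K + M h * (4 * K - M h) / K ^ 3 + max 0 (1 - real 0 * (d\<^sup>2 / K ^ 3)))"
    by (simp only: ennreal_ge_1)
  then show ?case by (rule order_trans[OF run_survival_le_1])
next
  case (Suc n)
  define \<phi> where "\<phi> t = t / K + t * (4 * K - t) / K ^ 3" for t
  \<comment> \<open>\<open>r\<close> starts at the trivial bound 1 and falls by the average drop
    guaranteed for \<open>\<phi>\<close> until it reaches 0.\<close>
  define r where "r n = max 0 (1 - real n * (d\<^sup>2 / K ^ 3))" for n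
  have M0: "0 \<le> M h" if "h \<in> H" for h using M that unfolding controlled_def by blast
  have "run_survival Y S1 S2 (Suc n) h \<le> ennreal (\<phi> (M h) + r (Suc n))"
  proof (cases "M h \<ge> K \<or> current h \<in> Y")
    case True
    then consider "current h \<in> Y" | "M h \<ge> K" by blast
    then show ?thesis
    proof cases
      case 1
      then show ?thesis by (simp only: run_survival_terminal) simp
    next
      case 2
      have "0 \<le> M h * (4 * K - M h) / K ^ 3" using 2 Suc.prems K by simp
      moreover have "1 \<le> M h / K" using 2 K by simp
      ultimately have "1 \<le> \<phi> (M h) + r (Suc n)" by (simp add: \<phi>_def r_def)
      then have "1 \<le> ennreal (\<phi> (M h) + r (Suc n))" by (simp only: ennreal_ge_1)
      then show ?thesis by (rule order_trans[OF run_survival_le_1])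
    qed
  next
    case False
    then have nt: "current h \<notin> Y" and MK: "M h < K" by auto
    obtain p where p: "\<And>c y. y \<in> set_pmf (if c then S1 h else S2 h) \<Longrightarrow>
        M (extend_play h c y) \<le> (if c = p then M h + a h else M h - a h)"
      using M Suc.prems nt unfolding controlled_def by meson
    have ext: "extend_play h c y \<in> H" if "y \<in> set_pmf (if c then S1 h else S2 h)" for c y
      using H Suc.prems nt that unfolding steps_within_def by blast
    have aM: "a h \<le> M h"
    proof -
      obtain y where y: "y \<in> set_pmf (if \<not> p then S1 h else S2 h)"
        by (metis ex_in_conv set_pmf_not_empty)
      then show ?thesis using p[OF y] M0[OF ext[OF y]] by auto
    qed
    have a: "d \<le> a h" using d(2) Suc.prems nt by blast
    have mono: "\<phi> s \<le> \<phi> t" if "0 \<le> s" "s \<le> t" "t \<le> 2 * K" for s t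
    proof -
      have "s * (4 * K - s) \<le> t * (4 * K - t)"
      proof -
        have "0 \<le> (t - s) * (4 * K - s - t)" using that by (intro mult_nonneg_nonneg) auto
        then show ?thesis by (simp add: algebra_simps)
      qed
      then show ?thesis using K that unfolding \<phi>_def
        by (intro add_mono divide_right_mono) auto
    qed
    have \<phi>0: "0 \<le> \<phi> t" if "0 \<le> t" "t \<le> 2 * K" for t
      using mono[of 0 t] that by (simp add: \<phi>_def)
    have r0: "0 \<le> r n" by (simp add: r_def)
    have "run_survival Y S1 S2 (Suc n) h \<le> (ennreal (\<phi> (M h + a h) + r n) + ennreal (\<phi> (M h - a h) + r n)) / 2"
      unfolding run_survival_Suc
    proof (rule nn_integral_play_step_le[OF nt, where p = p])
      fix c y assume y: "y \<in> set_pmf (if c then S1 h else S2 h)"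
      let ?b = "if c = p then M h + a h else M h - a h"
      have b: "?b \<le> 2 * K" using MK aM a d(1) by auto
      have "run_survival Y S1 S2 n (extend_play h c y) \<le> ennreal (\<phi> (M (extend_play h c y)) + r n)"
        using Suc.IH[OF ext[OF y]] p[OF y] b unfolding \<phi>_def r_def by linarith
      also have "\<dots> \<le> ennreal (\<phi> ?b + r n)"
        using mono[OF M0[OF ext[OF y]] p[OF y] b] by (intro ennreal_leI) linarith
      finally show "run_survival Y S1 S2 n (extend_play h c y) \<le>
        (if c = p then ennreal (\<phi> (M h + a h) + r n) else ennreal (\<phi> (M h - a h) + r n))"
        by (simp split: if_splits)
    qed
    also have "\<dots> = ennreal ((\<phi> (M h + a h) + r n + (\<phi> (M h - a h) + r n)) / 2)"
      using \<phi>0[of "M h + a h"] \<phi>0[of "M h - a h"] aM MK a d(1) r0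
      by (simp add: divide_ennreal flip: ennreal_plus ennreal_numeral)
    also have "\<dots> \<le> ennreal (\<phi> (M h) + r (Suc n))"
    proof (rule ennreal_leI)
      \<comment> \<open>The linear parts cancel; the quadratic term of \<open>\<phi>\<close> gives
        the drop.\<close>
      have "(\<phi> (M h + a h) + \<phi> (M h - a h)) / 2 = \<phi> (M h) - (a h)\<^sup>2 / K ^ 3"
        using K by (simp add: \<phi>_def field_simps power2_eq_square)
      moreover have "d\<^sup>2 / K ^ 3 \<le> (a h)\<^sup>2 / K ^ 3"
        using a d(1) K by (intro divide_right_mono power_mono) auto
      moreover have "r n - d\<^sup>2 / K ^ 3 \<le> r (Suc n)"
      proof -
        have "0 \<le> d\<^sup>2 / K ^ 3" using K by simp
        moreover have "real (Suc n) * (d\<^sup>2 / K ^ 3) = real n * (d\<^sup>2 / K ^ 3) + d\<^sup>2 / K ^ 3"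
          by (simp only: of_nat_Suc distrib_right mult_1_left add.commute)
        ultimately show ?thesis unfolding r_def max_def by (simp only: split: if_split) linarith
      qed
      ultimately show "(\<phi> (M h + a h) + r n + (\<phi> (M h - a h) + r n)) / 2 \<le> \<phi> (M h) + r (Suc n)"
        by (simp add: field_simps)
    qed
    finally show ?thesis .
  qed
  then show ?case by (simp only: \<phi>_def r_def)
qed

text \<open>First \<open>K\<close> is taken large, which makes the concave part small at the start,
  then \<open>n\<close>, which brings the remaining term down to 0.\<close>

lemma controlled_terminates:
  assumes H: "steps_within Y S1 S2 H" and M: "controlled Y S1 S2 H M a"
    and d: "d > 0" "\<And>h. h \<in> H \<Longrightarrow> current h \<notin> Y \<Longrightarrow> d \<le> a h" and h: "h \<in> H"
  shows "terminal_integral Y S1 S2 (\<lambda>_. 1) h = 1"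
proof (rule terminates_if_survival_tendsto_0)
  fix e :: real assume e: "e > 0"
  define m where "m = M h"
  have m: "0 \<le> m" using M h unfolding controlled_def m_def by blast
  \<comment> \<open>The concave part at \<open>m\<close> is at most
    \<open>m / K + 4 * m / K^2\<close>, hence at most \<open>5 * m / K\<close>, which this
    \<open>K\<close> pushes below \<open>e\<close>.\<close>
  define K where "K = 1 + m + 5 * m / e"
  have K: "K \<ge> 1" "m \<le> K" "5 * m / e \<le> K" using m e by (auto simp: K_def)
  obtain n where "K ^ 3 / d\<^sup>2 < real n" using reals_Archimedean2 by blast
  then have n: "1 - real n * (d\<^sup>2 / K ^ 3) \<le> 0" using d(1) K by (simp add: field_simps)
  have "m / K + m * (4 * K - m) / K ^ 3 \<le> e"
  proof -
    have "m * (4 * K - m) / K ^ 3 \<le> m * (4 * K) / K ^ 3"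
      using m K by (intro divide_right_mono mult_left_mono) auto
    also have "\<dots> = 4 * m / K\<^sup>2" using K by (simp add: power3_eq_cube power2_eq_square)
    also have "\<dots> \<le> 4 * m / K"
      using m K self_le_power[of K 2] by (intro divide_left_mono) auto
    finally have "m / K + m * (4 * K - m) / K ^ 3 \<le> 5 * m / K" by simp
    also have "\<dots> \<le> e" using K e by (simp add: field_simps)
    finally show ?thesis .
  qed
  moreover have "run_survival Y S1 S2 n h \<le>
      ennreal (m / K + m * (4 * K - m) / K ^ 3 + max 0 (1 - real n * (d\<^sup>2 / K ^ 3)))"
    unfolding m_def using K m
    by (intro controlled_survival_le[OF H M d K(1) h]) (auto simp: m_def)
  ultimately show "\<exists>n. run_survival Y S1 S2 n h \<le> ennreal e"
    using n by (intro exI[of _ n]) (auto intro: order_trans ennreal_leI)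
qed

section \<open>The running payoff collected along a play\<close>

lemma current_start [simp]: "current (x, []) = x"
  by (simp add: current_def visited_def)

lemma current_extend_play [simp]: "current (extend_play h c y) = y"
  by (simp add: current_def visited_def extend_play_def)

definition accrued :: "('a \<Rightarrow> real) \<Rightarrow> 'a play \<Rightarrow> real" where
  "accrued f h = (\<Sum>z\<leftarrow>butlast (visited h). f z)"

lemma accrued_start [simp]: "accrued f (x, []) = 0"
  by (simp add: accrued_def visited_def)

lemma accrued_extend_play [simp]: "accrued f (extend_play h c y) = accrued f h + f (current h)"
proof -
  have "visited (extend_play h c y) = visited h @ [y]"
    by (simp add: visited_def extend_play_def)
  moreover have "visited h = butlast (visited h) @ [current h]"
    by (simp add: current_def visited_def)
  ultimately have "butlast (visited (extend_play h c y)) = butlast (visited h) @ [current h]"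
    by simp
  then show ?thesis by (simp add: accrued_def)
qed

lemma total_payoff_accrued: "total_payoff F f h = F (current h) + accrued f h"
  by (simp add: total_payoff_def accrued_def)

definition pure_strategy :: "('a play \<Rightarrow> 'a) \<Rightarrow> 'a strategy" where
  "pure_strategy s = (\<lambda>h. return_pmf (s h))"

lemma terminal_integral_ge:
  assumes H: "steps_within Y S1 S2 H" "h \<in> H"
    and g: "\<And>h. h \<in> H \<Longrightarrow> current h \<in> Y \<Longrightarrow> c \<le> g h"
  shows "c * terminal_integral Y S1 S2 (\<lambda>_. 1) h \<le> terminal_integral Y S1 S2 g h"
  unfolding terminal_integral_def SUP_mult_left_ennreal
proof (rule SUP_mono', goal_cases)
  case (1 n)
  have "c * (\<integral>\<^sup>+h'. 1 * indicator {h. current h \<in> Y} h' \<partial>run Y S1 S2 n h)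
      = (\<integral>\<^sup>+h'. c * indicator {h. current h \<in> Y} h' \<partial>run Y S1 S2 n h)"
    by (simp add: nn_integral_cmult)
  also have "\<dots> \<le> (\<integral>\<^sup>+h'. g h' * indicator {h. current h \<in> Y} h' \<partial>run Y S1 S2 n h)"
    using g run_within[OF H]
    by (intro nn_integral_mono_AE) (auto simp: AE_measure_pmf_iff indicator_def)
  finally show ?case .
qed

text \<open>Suprema need not be attained, so the bound is asked only for amounts strictly below
  \<open>s\<close> and \<open>t\<close>; continuity of addition and halving does the rest, one
  variable at a time. The alternative 0 keeps the range nonempty when \<open>s\<close> or
  \<open>t\<close> is 0.\<close>

lemma ennreal_half_sum_le:
  fixes c V s t :: ennreal
  assumes "\<And>s' t'. s' < s \<or> s' = 0 \<Longrightarrow> t' < t \<or> t' = 0 \<Longrightarrow> c + (s' + t') / 2 \<le> V"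
  shows "c + (s + t) / 2 \<le> V"
proof -
  have half: "c + (u + t) / 2 \<le> V"
    if le: "\<And>t'. t' < t \<or> t' = 0 \<Longrightarrow> c + (u + t') / 2 \<le> V" for u t :: ennreal
  proof -
    let ?B = "{t'. t' < t \<or> t' = 0}"
    have ne: "?B \<noteq> {}" by auto
    have sup: "Sup ?B = t"
    proof (rule antisym)
      show "t \<le> Sup ?B"
        by (rule dense_le) (auto intro: Sup_upper)
    qed (auto intro!: Sup_least)
    have "(SUP t'\<in>?B. c + (u + t') / 2) = c + (u + Sup ?B) / 2"
      using ennreal_SUP_add_right[OF ne, of u "\<lambda>t'. t'"]
      by (simp only: ennreal_SUP_add_right[OF ne, symmetric] SUP_divide_ennreal[symmetric] image_ident)
    then have "c + (u + t) / 2 = (SUP t'\<in>?B. c + (u + t') / 2)" by (simp only: sup)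
    also have "\<dots> \<le> V" by (intro SUP_least le) simp
    finally show ?thesis .
  qed
  have "c + (t + s) / 2 \<le> V"
  proof (rule half)
    fix s' assume s': "s' < s \<or> s' = 0"
    have "c + (s' + t) / 2 \<le> V" by (rule half) (rule assms[OF s'])
    then show "c + (t + s') / 2 \<le> V" by (simp only: add.commute)
  qed
  then show ?thesis by (simp add: add.commute)
qed

section \<open>The lower bound: the least fixed point is guaranteed to player I\<close>

text \<open>\<open>b\<close> shifts all payoffs into the nonnegative range, where integrals and
  fixed points live in \<open>ennreal\<close>. Both kinds of running payoff satisfy
  \<open>f_nonneg\<close>; they are separated only where player II has to force termination.\<close>

locale tug_of_war =
  fixes X Y :: "'a set" and E :: "('a \<times> 'a) set" and F f :: "'a \<Rightarrow> real" and b :: real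
  assumes edges: "E \<subseteq> X \<times> X"
    and terminal: "Y \<noteq> {}" "Y \<subseteq> X"
    and connected: "connected_graph X E"
    and undirected: "sym E"
    and f_nonneg: "\<And>z. z \<in> X - Y \<Longrightarrow> 0 \<le> f z"
    and F_ge: "\<And>y. y \<in> Y \<Longrightarrow> - b \<le> F y"
    and b_nonneg: "0 \<le> b"
begin

abbreviation "legal \<equiv> legal_plays X E Y"

definition legal_choice :: "('a play \<Rightarrow> 'a) \<Rightarrow> bool" where
  "legal_choice s \<longleftrightarrow> (\<forall>h\<in>legal. current h \<notin> Y \<longrightarrow> (current h, s h) \<in> E)"

lemma legal_choice_deterministic: "legal_choice s \<Longrightarrow> pure_strategy s \<in> deterministic_strategies X E Y"
  by (auto simp: legal_choice_def pure_strategy_def deterministic_strategies_def)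

lemma deterministic_subset_random: "deterministic_strategies X E Y \<subseteq> random_strategies X E Y"
  by (auto simp: deterministic_strategies_def random_strategies_def)

lemma legal_choice_random: "legal_choice s \<Longrightarrow> pure_strategy s \<in> random_strategies X E Y"
  using legal_choice_deterministic deterministic_subset_random by blast

lemma legal_current: "h \<in> legal \<Longrightarrow> current h \<in> X"
  by (induction rule: legal_plays.induct) (use edges in auto)

lemma legal_accrued_nonneg: "h \<in> legal \<Longrightarrow> 0 \<le> accrued f h"
  by (induction rule: legal_plays.induct) (use f_nonneg legal_current in auto)

lemma random_strategies_move:
  assumes "S1 \<in> random_strategies X E Y" "S2 \<in> random_strategies X E Y"
    and "h \<in> legal" "current h \<notin> Y" "y \<in> set_pmf (if c then S1 h else S2 h)"
  shows "(current h, y) \<in> E"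
  using assms by (auto simp: random_strategies_def split: if_splits)

lemma steps_within_legal:
  assumes "S1 \<in> random_strategies X E Y" "S2 \<in> random_strategies X E Y"
    and "\<And>h c y. h \<in> legal \<Longrightarrow> h \<in> H \<Longrightarrow> current h \<notin> Y \<Longrightarrow> (current h, y) \<in> E \<Longrightarrow> extend_play h c y \<in> H"
  shows "steps_within Y S1 S2 (legal \<inter> H)"
  unfolding steps_within_def
proof (intro ballI impI allI)
  fix h c y assume h: "h \<in> legal \<inter> H" "current h \<notin> Y" and y: "y \<in> set_pmf (if c then S1 h else S2 h)"
  then have "(current h, y) \<in> E" using random_strategies_move assms by blast
  then show "extend_play h c y \<in> legal \<inter> H" using h assms(3)[of h y c] legal_plays.move[of h X E Y y c] by simp
qed

lemma path_to_terminal: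
  assumes "z \<in> X" obtains y where "y \<in> Y" "(z, y) \<in> E\<^sup>*"
  using assms terminal connected by (auto simp: connected_graph_def)

lemma neighbour_exists:
  assumes "z \<in> X" "z \<notin> Y" obtains y where "(z, y) \<in> E"
proof -
  obtain y where "y \<in> Y" "(z, y) \<in> E\<^sup>*" using path_to_terminal assms by blast
  then show ?thesis using that assms(2) by (metis converse_rtranclE)
qed

section \<open>Distance to the terminal set\<close>

definition target_dist :: "'a \<Rightarrow> nat" where
  "target_dist z = (LEAST n. \<exists>y\<in>Y. (z, y) \<in> E ^^ n)"

lemma target_dist_attained:
  assumes "z \<in> X" obtains y where "y \<in> Y" "(z, y) \<in> E ^^ target_dist z"
proof -
  obtain y n where "y \<in> Y" "(z, y) \<in> E ^^ n"
    using path_to_terminal[OF assms] by (metis rtrancl_imp_relpow)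
  then have "\<exists>n. \<exists>y\<in>Y. (z, y) \<in> E ^^ n" by blast
  then have "\<exists>y\<in>Y. (z, y) \<in> E ^^ target_dist z"
    unfolding target_dist_def by (rule LeastI_ex)
  then show ?thesis using that by blast
qed

text \<open>The edge can be walked back, from \<open>y\<close> to \<open>z\<close> and on along a
  shortest path; this uses that \<open>E\<close> is undirected.\<close>

lemma target_dist_neighbour_le:
  assumes "(z, y) \<in> E"
  shows "target_dist y \<le> Suc (target_dist z)"
proof -
  obtain t where t: "t \<in> Y" "(z, t) \<in> E ^^ target_dist z"
    using target_dist_attained assms edges by blast
  have "(y, z) \<in> E" using undirected assms by (auto dest: symD)
  then have "(y, t) \<in> E ^^ Suc (target_dist z)" using t(2) by (rule relpow_Suc_I2)
  then show ?thesis unfolding target_dist_def[of y] using t(1) by (intro Least_le) blast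
qed

lemma target_dist_neighbour_less:
  assumes "z \<in> X" "z \<notin> Y" obtains y where "(z, y) \<in> E" "Suc (target_dist y) \<le> target_dist z"
proof -
  obtain t where t: "t \<in> Y" "(z, t) \<in> E ^^ target_dist z"
    using target_dist_attained assms by blast
  obtain n where n: "target_dist z = Suc n"
    using t assms by (cases "target_dist z") auto
  then obtain y where y: "(z, y) \<in> E" "(y, t) \<in> E ^^ n"
    using t(2) by (metis relpow_Suc_D2)
  then have "target_dist y \<le> n"
    unfolding target_dist_def[of y] using t(1) by (intro Least_le) blast
  with n y that show ?thesis by auto
qed

definition approach :: "'a play \<Rightarrow> 'a" where
  "approach h = (SOME y. (current h, y) \<in> E \<and> Suc (target_dist y) \<le> target_dist (current h))"

lemma approach:
  assumes "h \<in> legal" "current h \<notin> Y"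
  shows "(current h, approach h) \<in> E" "Suc (target_dist (approach h)) \<le> target_dist (current h)"
proof -
  have "\<exists>y. (current h, y) \<in> E \<and> Suc (target_dist y) \<le> target_dist (current h)"
    using target_dist_neighbour_less legal_current assms by metis
  from someI_ex[OF this] show "(current h, approach h) \<in> E"
    "Suc (target_dist (approach h)) \<le> target_dist (current h)"
    unfolding approach_def by auto
qed

lemma legal_choice_approach: "legal_choice approach"
  by (simp add: legal_choice_def approach)

text \<open>The distance to \<open>Y\<close> is a potential with constant step size 1: it falls when
  player I wins the toss and rises by at most 1 otherwise.\<close>

lemma approach_terminates:
  assumes S2: "S2 \<in> random_strategies X E Y" and h: "h \<in> legal"
  shows "terminal_integral Y (pure_strategy approach) S2 (\<lambda>_. 1) h = 1"
proof (rule controlled_terminates)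
  let ?S1 = "pure_strategy approach"
  have S1: "?S1 \<in> random_strategies X E Y"
    by (rule legal_choice_random[OF legal_choice_approach])
  show "steps_within Y ?S1 S2 (legal \<inter> UNIV)"
    by (rule steps_within_legal[OF S1 S2]) simp
  show "controlled Y ?S1 S2 (legal \<inter> UNIV) (\<lambda>h. real (target_dist (current h))) (\<lambda>_. 1)"
    unfolding controlled_def
  proof (intro conjI ballI impI)
    fix h assume h: "h \<in> legal \<inter> UNIV" and nt: "current h \<notin> Y"
    show "\<exists>p. \<forall>c. \<forall>y\<in>set_pmf (if c then ?S1 h else S2 h).
        real (target_dist (current (extend_play h c y))) \<le>
          (if c = p then real (target_dist (current h)) + 1 else real (target_dist (current h)) - 1)"
    proof (intro exI[of _ False] allI ballI)
      fix c y assume y: "y \<in> set_pmf (if c then ?S1 h else S2 h)"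
      then have "(current h, y) \<in> E" using random_strategies_move[OF S1 S2] h nt by blast
      moreover have "y = approach h" if c using y that by (simp add: pure_strategy_def)
      ultimately show "real (target_dist (current (extend_play h c y))) \<le>
          (if c = False then real (target_dist (current h)) + 1 else real (target_dist (current h)) - 1)"
        using target_dist_neighbour_le[of "current h" y] approach(2)[of h] h nt by auto
    qed
  qed simp
qed (use h in auto)

section \<open>Amounts that player I can guarantee\<close>

definition shifted_payoff :: "'a play \<Rightarrow> ennreal" where
  "shifted_payoff h = ennreal (total_payoff F f h + b)"

lemma accrued_le_shifted_payoff:
  assumes "h \<in> legal" "current h \<in> Y"
  shows "ennreal (accrued f h) \<le> shifted_payoff h"
  unfolding shifted_payoff_def total_payoff_accrued using F_ge[OF assms(2)] by (intro ennreal_leI) auto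

text \<open>Asking for every history that ends in \<open>z\<close> lets strategies be glued after
  any round; the accrued payoff is added because \<open>shifted_payoff\<close> counts the whole
  play. Termination is part of the demand since \<open>F_minus\<close> punishes player I for an
  endless game. A deterministic strategy against all random ones covers both strategy
  classes.\<close>

definition guaranteed :: "'a \<Rightarrow> ennreal \<Rightarrow> bool" where
  "guaranteed z t \<longleftrightarrow> (\<forall>h\<in>legal. current h = z \<longrightarrow>
    (\<exists>s. legal_choice s \<and> (\<forall>S2\<in>random_strategies X E Y.
      terminal_integral Y (pure_strategy s) S2 (\<lambda>_. 1) h = 1 \<and>
      t + ennreal (accrued f h) \<le> terminal_integral Y (pure_strategy s) S2 shifted_payoff h)))"

lemma guaranteed_mono: "guaranteed z t \<Longrightarrow> t' \<le> t \<Longrightarrow> guaranteed z t'"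
  unfolding guaranteed_def by (meson add_right_mono order_trans)

text \<open>Running payoffs are nonnegative, so walking towards \<open>Y\<close> ends the game
  without losing what was accrued.\<close>

lemma guaranteed_0: "guaranteed z 0"
  unfolding guaranteed_def
proof (intro ballI impI exI[of _ approach] conjI legal_choice_approach)
  fix h S2 assume h: "h \<in> legal" and S2: "S2 \<in> random_strategies X E Y"
  let ?S1 = "pure_strategy approach"
  let ?H = "{h'. accrued f h \<le> accrued f h'}"
  have S1: "?S1 \<in> random_strategies X E Y"
    by (rule legal_choice_random[OF legal_choice_approach])
  show one: "terminal_integral Y ?S1 S2 (\<lambda>_. 1) h = 1"
    by (rule approach_terminates[OF S2 h])
  have "ennreal (accrued f h) * terminal_integral Y ?S1 S2 (\<lambda>_. 1) h
      \<le> terminal_integral Y ?S1 S2 shifted_payoff h"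
  proof (rule terminal_integral_ge)
    show "steps_within Y ?S1 S2 (legal \<inter> ?H)"
    proof (rule steps_within_legal[OF S1 S2])
      fix h' c y assume "h' \<in> legal" "h' \<in> ?H" "current h' \<notin> Y"
      then show "extend_play h' c y \<in> ?H"
        using f_nonneg[of "current h'"] legal_current[of h'] by auto
    qed
    show "h \<in> legal \<inter> ?H" using h by simp
    fix h' assume h': "h' \<in> legal \<inter> ?H" "current h' \<in> Y"
    then have "ennreal (accrued f h) \<le> ennreal (accrued f h')" by (intro ennreal_leI) auto
    also have "\<dots> \<le> shifted_payoff h'" using h' by (intro accrued_le_shifted_payoff) auto
    finally show "ennreal (accrued f h) \<le> shifted_payoff h'" .
  qed
  then show "0 + ennreal (accrued f h) \<le> terminal_integral Y ?S1 S2 shifted_payoff h"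
    by (simp add: one)
qed

lemma guaranteed_terminal:
  assumes "z \<in> Y"
  shows "guaranteed z (ennreal (F z + b))"
  unfolding guaranteed_def
proof (intro ballI impI exI[of _ approach] conjI legal_choice_approach)
  fix h S2 assume h: "h \<in> legal" "current h = z" and S2: "S2 \<in> random_strategies X E Y"
  let ?S1 = "pure_strategy approach"
  show "terminal_integral Y ?S1 S2 (\<lambda>_. 1) h = 1"
    by (rule approach_terminates[OF S2 h(1)])
  show "ennreal (F z + b) + ennreal (accrued f h) \<le> terminal_integral Y ?S1 S2 shifted_payoff h"
    using assms h F_ge[OF assms] legal_accrued_nonneg[OF h(1)]
    by (simp add: terminal_integral_terminal shifted_payoff_def total_payoff_accrued algebra_simps
        flip: ennreal_plus)
qed

text \<open>If player I wins the toss, he moves to \<open>y1\<close>; after this round he continues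
  with a strategy that suits its outcome, worth \<open>t1\<close> after a won toss and
  \<open>t2\<close> after a lost one.\<close>

lemma guaranteed_step:
  assumes z: "z \<in> X" "z \<notin> Y" and y1: "(z, y1) \<in> E" "guaranteed y1 t1"
    and t2: "\<And>y. (z, y) \<in> E \<Longrightarrow> guaranteed y t2"
  shows "guaranteed z (ennreal (f z) + (t1 + t2) / 2)"
  unfolding guaranteed_def
proof (intro ballI impI)
  fix h assume h: "h \<in> legal" "current h = z"
  then have nt: "current h \<notin> Y" using z by simp
  define t where "t c = (if c then t1 else t2)" for c
  \<comment> \<open>One continuation for each outcome \<open>cy\<close> of the next round, the coin
    included since the promised amount depends on it. Outcomes outside the premise get
    \<open>approach\<close>, merely to keep the choice legal.\<close>
  have "\<forall>cy. \<exists>s. legal_choice s \<and> ((z, snd cy) \<in> E \<and> (fst cy \<longrightarrow> snd cy = y1) \<longrightarrow>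
    (\<forall>S2\<in>random_strategies X E Y.
      terminal_integral Y (pure_strategy s) S2 (\<lambda>_. 1) (extend_play h (fst cy) (snd cy)) = 1 \<and>
      t (fst cy) + ennreal (accrued f h + f z) \<le>
        terminal_integral Y (pure_strategy s) S2 shifted_payoff (extend_play h (fst cy) (snd cy))))"
  proof
    fix cy :: "bool \<times> 'a"
    show "\<exists>s. legal_choice s \<and> ((z, snd cy) \<in> E \<and> (fst cy \<longrightarrow> snd cy = y1) \<longrightarrow>
      (\<forall>S2\<in>random_strategies X E Y.
        terminal_integral Y (pure_strategy s) S2 (\<lambda>_. 1) (extend_play h (fst cy) (snd cy)) = 1 \<and>
        t (fst cy) + ennreal (accrued f h + f z) \<le>
          terminal_integral Y (pure_strategy s) S2 shifted_payoff (extend_play h (fst cy) (snd cy))))"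
    proof (cases "(z, snd cy) \<in> E \<and> (fst cy \<longrightarrow> snd cy = y1)")
      case True
      then have g: "guaranteed (snd cy) (t (fst cy))" using y1 t2 by (auto simp: t_def)
      have "extend_play h (fst cy) (snd cy) \<in> legal"
        using True h nt by (auto intro: legal_plays.move)
      with g h show ?thesis unfolding guaranteed_def by (metis accrued_extend_play current_extend_play)
    next
      case False
      then show ?thesis using legal_choice_approach by blast
    qed
  qed
  then obtain s where s: "\<And>cy. legal_choice (s cy)"
    and guarantee: "\<And>c y S2. (z, y) \<in> E \<Longrightarrow> (c \<longrightarrow> y = y1) \<Longrightarrow> S2 \<in> random_strategies X E Y \<Longrightarrow>
      terminal_integral Y (pure_strategy (s (c, y))) S2 (\<lambda>_. 1) (extend_play h c y) = 1 \<and>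
      t c + ennreal (accrued f h + f z) \<le>
        terminal_integral Y (pure_strategy (s (c, y))) S2 shifted_payoff (extend_play h c y)"
    by (metis fst_conv snd_conv)
  define n where "n = length (snd h)"
  \<comment> \<open>Rounds are indexed from 0, so entry \<open>n\<close> is the round following
    \<open>h\<close>; it tells which continuation to use. For histories unrelated to
    \<open>h\<close> the choice only has to be legal.\<close>
  define glued where "glued h' = (if length (snd h') > n then s (snd h' ! n) h'
    else if h' = h then y1 else approach h')" for h'
  have glued: "legal_choice glued"
    using s y1 h approach(1) by (auto simp: legal_choice_def glued_def)
  have cong: "terminal_integral Y (pure_strategy glued) S2 g (extend_play h c y) =
      terminal_integral Y (pure_strategy (s (c, y))) S2 g (extend_play h c y)" for S2 g c y
    by (rule terminal_integral_cong_strategy)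
      (simp_all add: pure_strategy_def glued_def extend_play_def n_def nth_append)
  show "\<exists>s. legal_choice s \<and> (\<forall>S2\<in>random_strategies X E Y.
      terminal_integral Y (pure_strategy s) S2 (\<lambda>_. 1) h = 1 \<and>
      ennreal (f z) + (t1 + t2) / 2 + ennreal (accrued f h) \<le>
        terminal_integral Y (pure_strategy s) S2 shifted_payoff h)"
  proof (intro exI[of _ glued] conjI ballI glued)
    fix S2 assume S2: "S2 \<in> random_strategies X E Y"
    let ?J = "terminal_integral Y (pure_strategy glued) S2"
    have start: "glued h = y1" by (simp add: glued_def n_def)
    have split: "?J g h = (?J g (extend_play h True y1) + (\<integral>\<^sup>+y. ?J g (extend_play h False y) \<partial>S2 h)) / 2" for g
      by (subst terminal_integral_play_step, subst nn_integral_play_step[OF nt])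
        (simp add: pure_strategy_def start)
    have S2_move: "(z, y) \<in> E" if "y \<in> set_pmf (S2 h)" for y
      using S2 h nt that by (auto simp: random_strategies_def)
    have "(\<integral>\<^sup>+y. ?J (\<lambda>_. 1) (extend_play h False y) \<partial>S2 h) = (\<integral>\<^sup>+y. 1 \<partial>S2 h)"
      using guarantee[OF S2_move _ S2, of _ False]
      by (intro nn_integral_cong_AE) (auto simp: AE_measure_pmf_iff cong)
    then have "?J (\<lambda>_. 1) h = (1 + 1) / 2"
      using guarantee[OF y1(1) _ S2, of True] by (simp add: split cong)
    also have "\<dots> = 1" by (simp add: one_add_one)
    finally show "?J (\<lambda>_. 1) h = 1" .
    have nonneg: "0 \<le> accrued f h" "0 \<le> f z"
      using legal_accrued_nonneg h f_nonneg z by auto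
    have "t1 + ennreal (accrued f h + f z) \<le> ?J shifted_payoff (extend_play h True y1)"
      using guarantee[OF y1(1) _ S2, of True] by (simp add: cong t_def)
    moreover have "t2 + ennreal (accrued f h + f z) \<le> (\<integral>\<^sup>+y. ?J shifted_payoff (extend_play h False y) \<partial>S2 h)"
      using guarantee[OF S2_move _ S2, of _ False]
      by (intro nn_integral_pmf_ge_const) (simp add: cong t_def)
    ultimately have "((t1 + ennreal (accrued f h + f z)) + (t2 + ennreal (accrued f h + f z))) / 2 \<le> ?J shifted_payoff h"
      unfolding split by (intro divide_right_mono_ennreal add_mono)
    moreover have "((t1 + ennreal (accrued f h + f z)) + (t2 + ennreal (accrued f h + f z))) / 2
        = ennreal (f z) + (t1 + t2) / 2 + ennreal (accrued f h)"
    proof -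
      have "((t1 + ennreal (accrued f h + f z)) + (t2 + ennreal (accrued f h + f z))) / 2
        = (t1 + t2) / 2 + (ennreal (accrued f h + f z) + ennreal (accrued f h + f z)) / 2"
        by (simp add: ac_simps flip: add_divide_distrib_ennreal)
      also have "(ennreal (accrued f h + f z) + ennreal (accrued f h + f z)) / 2 = ennreal (accrued f h + f z)"
        using nonneg by (simp add: ennreal_divide_numeral flip: ennreal_plus)
      finally show ?thesis using nonneg by (simp add: ac_simps)
    qed
    ultimately show "ennreal (f z) + (t1 + t2) / 2 + ennreal (accrued f h) \<le> ?J shifted_payoff h"
      by simp
  qed
qed

section \<open>The one-step operator and its least fixed point\<close>

definition value_step :: "('a \<Rightarrow> ennreal) \<Rightarrow> 'a \<Rightarrow> ennreal" where
  "value_step v z = (if z \<in> Y then ennreal (F z + b)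
    else if z \<in> X then ennreal (f z) + ((SUP y\<in>E `` {z}. v y) + (INF y\<in>E `` {z}. v y)) / 2
    else 0)"

definition shifted_value :: "'a \<Rightarrow> ennreal" where
  "shifted_value = lfp value_step"

lemma mono_value_step: "mono value_step"
proof (intro monoI le_funI)
  fix v w :: "'a \<Rightarrow> ennreal" and z assume "v \<le> w"
  then have "v y \<le> w y" for y by (simp add: le_fun_def)
  then show "value_step v z \<le> value_step w z"
    unfolding value_step_def
    by (auto intro!: add_left_mono divide_right_mono_ennreal add_mono SUP_mono' INF_mono')
qed

lemma shifted_value_unfold: "shifted_value = value_step shifted_value"
  unfolding shifted_value_def by (rule lfp_unfold[OF mono_value_step])

lemma guaranteed_below_shifted_value:
  assumes "z \<in> X" "t < shifted_value z \<or> t = 0"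
  shows "guaranteed z t"
proof -
  \<comment> \<open>The value \<open>top\<close> outside \<open>X\<close> makes the comparison
    trivial there.\<close>
  define v where "v z = (if z \<in> X then Sup {t. guaranteed z t} else top)" for z
  have v: "guaranteed z t" if v: "z \<in> X" "t < v z \<or> t = 0" for z t
  proof (cases "t = 0")
    case False
    then obtain t' where "guaranteed z t'" "t < t'"
      using v by (auto simp: v_def less_Sup_iff)
    then show ?thesis using guaranteed_mono less_imp_le by blast
  qed (simp add: guaranteed_0)
  have le_v: "t \<le> v z" if "guaranteed z t" for z t
    using that by (auto simp: v_def intro: Sup_upper)
  have "value_step v z \<le> v z" for z
  proof -
    consider "z \<in> Y" | "z \<in> X" "z \<notin> Y" | "z \<notin> X" by auto
    then show ?thesis
    proof cases
      case 1
      then show ?thesis using le_v[OF guaranteed_terminal] by (simp add: value_step_def)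
    next
      case 2
      obtain y0 where y0: "(z, y0) \<in> E" using neighbour_exists 2 by blast
      have "ennreal (f z) + ((SUP y\<in>E `` {z}. v y) + (INF y\<in>E `` {z}. v y)) / 2 \<le> v z"
      proof (rule ennreal_half_sum_le)
        fix s t assume s: "s < (SUP y\<in>E `` {z}. v y) \<or> s = 0" and t: "t < (INF y\<in>E `` {z}. v y) \<or> t = 0"
        \<comment> \<open>A neighbour almost attaining the supremum serves as the move of player I;
          below the infimum, every neighbour guarantees \<open>t\<close>.\<close>
        obtain y1 where y1: "(z, y1) \<in> E" "s < v y1 \<or> s = 0"
          using s y0 by (auto simp: less_SUP_iff)
        have "guaranteed y1 s" using v y1 edges by blast
        moreover have "guaranteed y t" if "(z, y) \<in> E" for y
        proof -
          have "t < v y \<or> t = 0" using t that by (auto dest: less_INF_D)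
          then show ?thesis using v that edges by blast
        qed
        ultimately show "ennreal (f z) + (s + t) / 2 \<le> v z"
          using y1 2 by (intro le_v guaranteed_step)
      qed
      then show ?thesis using 2 by (simp add: value_step_def)
    next
      case 3
      then show ?thesis by (simp add: v_def)
    qed
  qed
  then have "shifted_value \<le> v"
    unfolding shifted_value_def by (intro lfp_lowerbound le_funI)
  then have "shifted_value z \<le> v z" by (simp add: le_fun_def)
  then have "t < v z \<or> t = 0" using assms(2) by (auto elim: less_le_trans)
  then show ?thesis by (rule v[OF assms(1)])
qed

section \<open>The upper bound: strategies of player II from supersolutions\<close>

text \<open>Where the value is infinite there is nothing to prove for player II; elsewhere the
  argument uses real numbers.\<close>

definition finite_states :: "'a set" where
  "finite_states = {z \<in> X. shifted_value z < top}"

definition real_value :: "'a \<Rightarrow> real" where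
  "real_value z = enn2real (shifted_value z)"

text \<open>At a nonterminal state of finite value, \<open>real_value z - f z\<close> is the
  midpoint between the supremum and the infimum of the value over the neighbours; this is its
  distance to both.\<close>

definition slope :: "'a \<Rightarrow> real" where
  "slope z = (enn2real (SUP y\<in>E `` {z}. shifted_value y) - enn2real (INF y\<in>E `` {z}. shifted_value y)) / 2"

lemma shifted_value_terminal: "y \<in> Y \<Longrightarrow> shifted_value y = ennreal (F y + b)"
  by (subst shifted_value_unfold) (simp add: value_step_def)

lemma terminal_finite: "y \<in> Y \<Longrightarrow> y \<in> finite_states"
  using terminal by (auto simp: finite_states_def shifted_value_terminal)

lemma real_value_terminal: "y \<in> Y \<Longrightarrow> real_value y = F y + b"
  using F_ge[of y] by (simp add: real_value_def shifted_value_terminal)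

lemma real_value_nonneg: "0 \<le> real_value z"
  by (simp add: real_value_def)

lemma ennreal_real_value: "z \<in> finite_states \<Longrightarrow> ennreal (real_value z) = shifted_value z"
  by (simp add: real_value_def finite_states_def)

context
  fixes z assumes z: "z \<in> finite_states" "z \<notin> Y"
begin

text \<open>A finite left-hand side of the fixed point equation forces supremum and infimum to be
  finite, so the equation passes to the reals.\<close>

private lemma SUP_INF_finite:
  "(SUP y\<in>E `` {z}. shifted_value y) < top" "(INF y\<in>E `` {z}. shifted_value y) < top"
  "real_value z = f z + (enn2real (SUP y\<in>E `` {z}. shifted_value y) +
    enn2real (INF y\<in>E `` {z}. shifted_value y)) / 2"
proof -
  let ?s = "SUP y\<in>E `` {z}. shifted_value y" and ?i = "INF y\<in>E `` {z}. shifted_value y"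
  have zX: "z \<in> X" using z by (simp add: finite_states_def)
  have eq: "shifted_value z = ennreal (f z) + (?s + ?i) / 2"
    by (subst shifted_value_unfold) (use z zX in \<open>simp add: value_step_def\<close>)
  have "shifted_value z \<noteq> top" using z by (auto simp: finite_states_def)
  then have "?s + ?i \<noteq> top" unfolding eq by (auto simp: ennreal_divide_eq_top_iff)
  then show fin: "?s < top" "?i < top"
    by (simp_all only: ennreal_add_eq_top de_Morgan_disj less_top)
  obtain s i where si: "?s = ennreal s" "?i = ennreal i" "0 \<le> s" "0 \<le> i"
    using fin by (cases ?s; cases ?i) auto
  have "shifted_value z = ennreal (f z + (s + i) / 2)"
    using si f_nonneg[of z] z zX by (simp add: eq ennreal_divide_numeral flip: ennreal_plus)
  then show "real_value z = f z + (enn2real ?s + enn2real ?i) / 2"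
    using si f_nonneg[of z] z zX by (simp add: real_value_def del: ennreal_plus)
qed

lemma finite_neighbour:
  assumes "(z, y) \<in> E" shows "y \<in> finite_states"
proof -
  have "shifted_value y \<le> (SUP y\<in>E `` {z}. shifted_value y)"
    using assms by (intro SUP_upper) auto
  also have "\<dots> < top" by (rule SUP_INF_finite)
  finally show ?thesis using assms edges by (auto simp: finite_states_def)
qed

lemma slope_upper:
  assumes "(z, y) \<in> E" shows "real_value y + f z \<le> real_value z + slope z"
proof -
  have "real_value y \<le> enn2real (SUP y\<in>E `` {z}. shifted_value y)"
    unfolding real_value_def using assms SUP_INF_finite by (intro enn2real_mono SUP_upper) auto
  then show ?thesis by (simp add: SUP_INF_finite(3) slope_def field_simps)
qed

lemma slope_lower:
  assumes "(z, y) \<in> E" shows "real_value z - slope z \<le> real_value y + f z"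
proof -
  have "enn2real (INF y\<in>E `` {z}. shifted_value y) \<le> real_value y"
    unfolding real_value_def using assms finite_neighbour[OF assms]
    by (intro enn2real_mono INF_lower) (auto simp: finite_states_def)
  then show ?thesis by (simp add: SUP_INF_finite(3) slope_def field_simps)
qed

lemma slope_approx:
  assumes "e > 0" obtains y where "(z, y) \<in> E" "real_value y + f z \<le> real_value z - slope z + e"
proof -
  let ?i = "INF y\<in>E `` {z}. shifted_value y"
  have i: "?i = ennreal (enn2real ?i)" using SUP_INF_finite(2) by simp
  have "?i < ennreal (enn2real ?i + e)"
    by (subst i) (use assms in \<open>simp add: ennreal_less_iff\<close>)
  then obtain y where y: "(z, y) \<in> E" "shifted_value y < ennreal (enn2real ?i + e)"
    by (auto simp: INF_less_iff)
  then have "ennreal (real_value y) < ennreal (enn2real ?i + e)"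
    by (simp add: ennreal_real_value finite_neighbour)
  then have "real_value y \<le> enn2real ?i + e"
    by (simp add: ennreal_less_iff real_value_nonneg)
  then have "real_value y + f z \<le> real_value z - slope z + e"
    by (simp add: SUP_INF_finite(3) slope_def field_simps)
  with y(1) that show thesis by blast
qed

end

section \<open>Almost greedy play for a supersolution\<close>

definition finite_plays :: "'a play set" where
  "finite_plays = legal \<inter> {h. current h \<in> finite_states}"

text \<open>
  The terms \<open>e / 2\<^sup>n\<close> pay for the fact that the best move of player II need not be attained.
\<close>

definition play_potential :: "('a \<Rightarrow> real) \<Rightarrow> real \<Rightarrow> 'a play \<Rightarrow> real" where
  "play_potential w e h = accrued f h + w (current h) + e / 2 ^ length (snd h)"

text \<open>Averaging the two bounds shows that \<open>w\<close> is at least \<open>f\<close> plus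
  the mean of its supremum and infimum over the neighbours. The step size \<open>a\<close> is a
  separate parameter because, for \<open>f = 0\<close>, termination is read off from a lower bound
  on it.\<close>

definition supersolution :: "('a \<Rightarrow> real) \<Rightarrow> ('a \<Rightarrow> real) \<Rightarrow> bool" where
  "supersolution w a \<longleftrightarrow> (\<forall>z\<in>finite_states. 0 \<le> w z) \<and> (\<forall>y\<in>Y. w y = F y + b) \<and>
    (\<forall>z\<in>finite_states - Y. (\<forall>y. (z, y) \<in> E \<longrightarrow> w y + f z \<le> w z + a z) \<and>
      (\<forall>e>0. \<exists>y. (z, y) \<in> E \<and> w y + f z \<le> w z - a z + e))"

lemma real_value_supersolution: "supersolution real_value slope"
  unfolding supersolution_def
  using slope_upper slope_approx by (auto simp: real_value_nonneg real_value_terminal) metis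

text \<open>After \<open>n\<close> rounds player II moves greedily up to an error
  \<open>e / 2^n\<close>. The error occurs with one coin outcome only, so it costs
  \<open>e / 2^(n+1)\<close> on average, precisely the decrease of the error term in the
  potential.\<close>

lemma supersolution_strategy:
  assumes w: "supersolution w a" and e: "e > 0"
  obtains s where "legal_choice s"
    and "\<And>S1. S1 \<in> random_strategies X E Y \<Longrightarrow> steps_within Y S1 (pure_strategy s) finite_plays"
    and "\<And>S1. S1 \<in> random_strategies X E Y \<Longrightarrow>
      controlled Y S1 (pure_strategy s) finite_plays (play_potential w e)
        (\<lambda>h. a (current h) - e / 2 ^ Suc (length (snd h)))"
    and "\<And>S1 x. S1 \<in> random_strategies X E Y \<Longrightarrow> x \<in> finite_states \<Longrightarrow>
      terminal_integral Y S1 (pure_strategy s) shifted_payoff (x, []) \<le> ennreal (w x + e)"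
proof -
  \<comment> \<open>Outside \<open>finite_states\<close> a move only has to be legal, because
    \<open>s\<close> must be legal on all plays.\<close>
  define good where "good h y \<longleftrightarrow> (current h, y) \<in> E \<and>
    (current h \<in> finite_states \<longrightarrow>
      w y + f (current h) \<le> w (current h) - a (current h) + e / 2 ^ length (snd h))" for h y
  define s where "s h = (SOME y. good h y)" for h
  have s: "good h (s h)" if h: "h \<in> legal" "current h \<notin> Y" for h
  proof -
    have "\<exists>y. good h y"
    proof (cases "current h \<in> finite_states")
      case True
      moreover have "0 < e / 2 ^ length (snd h)" using e by simp
      ultimately show ?thesis using w h unfolding supersolution_def good_def by blast
    next
      case False
      then show ?thesis
        using neighbour_exists[OF legal_current[OF h(1)] h(2)] unfolding good_def by blast
    qed
    then show ?thesis unfolding s_def by (rule someI_ex)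
  qed
  have legal: "legal_choice s" using s by (simp add: legal_choice_def good_def)
  have within: "steps_within Y S1 (pure_strategy s) finite_plays"
    if "S1 \<in> random_strategies X E Y" for S1
    unfolding finite_plays_def
    by (rule steps_within_legal[OF that legal_choice_random[OF legal]]) (simp add: finite_neighbour)
  have controlled: "controlled Y S1 (pure_strategy s) finite_plays (play_potential w e)
      (\<lambda>h. a (current h) - e / 2 ^ Suc (length (snd h)))"
    if S1: "S1 \<in> random_strategies X E Y" for S1
    unfolding controlled_def
  proof (intro conjI ballI impI)
    fix h assume h: "h \<in> finite_plays"
    then show "0 \<le> play_potential w e h"
      using w e legal_accrued_nonneg[of h]
      by (auto simp: finite_plays_def play_potential_def supersolution_def intro!: add_nonneg_nonneg)
    assume nt: "current h \<notin> Y"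
    \<comment> \<open>The error term falls from \<open>2 * q\<close> to \<open>q\<close>; this turns
      the change \<open>a\<close> into \<open>a - q\<close> upwards and \<open>- a + 2 * q\<close>
      into \<open>- (a - q)\<close> downwards.\<close>
    define q where "q = e / 2 ^ Suc (length (snd h))"
    have M: "play_potential w e h = accrued f h + w (current h) + 2 * q"
      "play_potential w e (extend_play h c y) = accrued f h + f (current h) + w y + q" for c y
      by (simp_all add: q_def play_potential_def extend_play_def[of h c y, THEN arg_cong[of _ _ snd]])
    show "\<exists>p. \<forall>c. \<forall>y\<in>set_pmf (if c then S1 h else pure_strategy s h).
        play_potential w e (extend_play h c y) \<le>
          (if c = p then play_potential w e h + (a (current h) - e / 2 ^ Suc (length (snd h)))
           else play_potential w e h - (a (current h) - e / 2 ^ Suc (length (snd h))))"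
      unfolding M q_def[symmetric]
    proof (intro exI[of _ True] allI ballI)
      fix c y assume y: "y \<in> set_pmf (if c then S1 h else pure_strategy s h)"
      show "accrued f h + f (current h) + w y + q \<le>
          (if c = True then accrued f h + w (current h) + 2 * q + (a (current h) - q)
           else accrued f h + w (current h) + 2 * q - (a (current h) - q))"
      proof (cases c)
        case True
        have "(current h, y) \<in> E"
          using random_strategies_move[OF S1 legal_choice_random[OF legal] _ nt y] h
          by (simp add: finite_plays_def)
        then have "w y + f (current h) \<le> w (current h) + a (current h)"
          using w h nt unfolding supersolution_def finite_plays_def by blast
        then show ?thesis using True by simp
      next
        case False
        then have "y = s h" using y by (simp add: pure_strategy_def)
        then have "w y + f (current h) \<le> w (current h) - a (current h) + 2 * q"
          using s[of h] h nt by (simp add: good_def finite_plays_def q_def)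
        then show ?thesis using False by simp
      qed
    qed
  qed
  have "terminal_integral Y S1 (pure_strategy s) shifted_payoff (x, []) \<le> ennreal (w x + e)"
    if S1: "S1 \<in> random_strategies X E Y" and x: "x \<in> finite_states" for S1 x
  proof -
    have "terminal_integral Y S1 (pure_strategy s) shifted_payoff (x, [])
        \<le> ennreal (play_potential w e (x, []))"
    proof (rule controlled_terminal_integral_le[OF within[OF S1] controlled[OF S1]])
      show "(x, []) \<in> finite_plays"
        using x by (auto simp: finite_plays_def finite_states_def intro: legal_plays.start)
      fix h assume "h \<in> finite_plays" "current h \<in> Y"
      then show "shifted_payoff h \<le> ennreal (play_potential w e h)"
        unfolding shifted_payoff_def total_payoff_accrued play_potential_def
        using w e by (intro ennreal_leI) (simp add: supersolution_def)
    qed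
    then show ?thesis by (simp add: play_potential_def)
  qed
  with legal within controlled show thesis by (rule that)
qed

text \<open>A play still running after \<open>n\<close> rounds has accrued at least
  \<open>c * n\<close>, while the potential starts at \<open>B\<close> and does not grow in
  expectation. Markov's inequality bounds the survival probability by
  \<open>B / (c * n)\<close>.\<close>

lemma positive_running_cost_upper:
  assumes c: "c > 0" "\<And>z. z \<in> X - Y \<Longrightarrow> c \<le> f z"
    and x: "x \<in> finite_states" and e: "e > 0"
  obtains s where "legal_choice s"
    and "\<And>S1. S1 \<in> random_strategies X E Y \<Longrightarrow>
      terminal_integral Y S1 (pure_strategy s) (\<lambda>_. 1) (x, []) = 1 \<and>
      terminal_integral Y S1 (pure_strategy s) shifted_payoff (x, []) \<le> shifted_value x + ennreal e"
proof (rule supersolution_strategy[OF real_value_supersolution e])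
  fix s assume legal: "legal_choice s"
    and within: "\<And>S1. S1 \<in> random_strategies X E Y \<Longrightarrow> steps_within Y S1 (pure_strategy s) finite_plays"
    and controlled: "\<And>S1. S1 \<in> random_strategies X E Y \<Longrightarrow>
      controlled Y S1 (pure_strategy s) finite_plays (play_potential real_value e)
        (\<lambda>h. slope (current h) - e / 2 ^ Suc (length (snd h)))"
    and payoff: "\<And>S1 x. S1 \<in> random_strategies X E Y \<Longrightarrow> x \<in> finite_states \<Longrightarrow>
      terminal_integral Y S1 (pure_strategy s) shifted_payoff (x, []) \<le> ennreal (real_value x + e)"
  have start: "(x, []) \<in> finite_plays"
    using x by (auto simp: finite_plays_def finite_states_def intro: legal_plays.start)
  have accrued: "c * real (length (snd h)) \<le> accrued f h" if "h \<in> legal" for h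
    using that
  proof (induction rule: legal_plays.induct)
    case (move h y k)
    then have "c \<le> f (current h)" using c legal_current by blast
    moreover have "length (snd (extend_play h k y)) = Suc (length (snd h))"
      by (simp add: extend_play_def)
    ultimately show ?case using move by (simp add: algebra_simps)
  qed simp
  show thesis
  proof (rule that[OF legal], intro conjI)
    fix S1 assume S1: "S1 \<in> random_strategies X E Y"
    show "terminal_integral Y S1 (pure_strategy s) (\<lambda>_. 1) (x, []) = 1"
    proof (rule terminates_if_survival_tendsto_0)
      fix e' :: real assume e': "e' > 0"
      define B where "B = real_value x + e"
      have B: "B > 0" using e real_value_nonneg[of x] by (simp add: B_def)
      obtain n where n: "B / (c * e') < real n" using reals_Archimedean2 by blast
      have npos: "0 < c * real n" using n B c e' by (smt (verit) divide_pos_pos mult_pos_pos)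
      let ?R = "run Y S1 (pure_strategy s) n (x, [])"
      have "ennreal (c * real n) * run_survival Y S1 (pure_strategy s) n (x, [])
          = (\<integral>\<^sup>+h. ennreal (c * real n) * indicator {h. current h \<notin> Y} h \<partial>?R)"
        by (simp add: run_survival_def nn_integral_cmult)
      also have "\<dots> \<le> (\<integral>\<^sup>+h. ennreal (play_potential real_value e h) \<partial>?R)"
      proof (rule nn_integral_mono_AE, unfold AE_measure_pmf_iff, rule ballI)
        fix h assume h: "h \<in> set_pmf ?R"
        then have fin: "h \<in> finite_plays" by (rule run_within[OF within[OF S1] start])
        show "ennreal (c * real n) * indicator {h. current h \<notin> Y} h \<le> ennreal (play_potential real_value e h)"
        proof (cases "current h \<in> Y")
          case False
          then have "length (snd h) = n"
            using length_play_pmf[of h Y S1 "pure_strategy s" x n] h by (simp add: play_pmf_eq_run)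
          then have "c * real n \<le> play_potential real_value e h"
            using accrued[of h] fin e real_value_nonneg[of "current h"]
            by (auto simp: play_potential_def finite_plays_def intro!: add_increasing2)
          then show ?thesis using False by (simp add: ennreal_leI)
        qed simp
      qed
      also have "\<dots> \<le> ennreal (play_potential real_value e (x, []))"
        by (rule controlled_run_le[OF within[OF S1] controlled[OF S1] start])
      also have "\<dots> = ennreal B" by (simp add: play_potential_def B_def)
      also have "\<dots> \<le> ennreal (c * real n) * ennreal e'"
        using n npos c e' by (simp add: field_simps ennreal_leI flip: ennreal_mult'')
      finally have "ennreal (c * real n) * run_survival Y S1 (pure_strategy s) n (x, [])
          \<le> ennreal (c * real n) * ennreal e'" .
      moreover have "ennreal (c * real n) \<noteq> 0" using npos by (simp only: ennreal_eq_0_iff not_le)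
      ultimately have "run_survival Y S1 (pure_strategy s) n (x, []) \<le> ennreal e'"
        using ennreal_mult_le_mult_iff[OF _ ennreal_neq_top] by blast
      then show "\<exists>n. run_survival Y S1 (pure_strategy s) n (x, []) \<le> ennreal e'" by blast
    qed
    show "terminal_integral Y S1 (pure_strategy s) shifted_payoff (x, []) \<le> shifted_value x + ennreal e"
      using payoff[OF S1 x] e
      by (simp add: ennreal_real_value[OF x, symmetric] real_value_nonneg flip: ennreal_plus)
  qed
qed

text \<open>
  Without running payoff, the slope of the value may tend to zero along a play that uses greedy
  moves only.  So player II plays for another supersolution: off the set of states
  with slope above \<open>d\<close>, the value is replaced by its largest \<open>d\<close>-Lipschitz extension from
  that set.  It agrees with the value on that set, and greedy moves do not leave this set.
\<close>

definition steep_states :: "real \<Rightarrow> 'a set" where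
  "steep_states d = {z \<in> finite_states. z \<in> Y \<or> d < slope z}"

text \<open>Only the source has to be flat, so a path may end in a steep state but cannot pass
  through one.\<close>

definition flat_edges :: "real \<Rightarrow> ('a \<times> 'a) set" where
  "flat_edges d = {(p, q) \<in> E. p \<in> finite_states - steep_states d}"

definition path_costs :: "real \<Rightarrow> 'a \<Rightarrow> real set" where
  "path_costs d z = {real_value v + d * real k | v k. v \<in> steep_states d \<and> (z, v) \<in> flat_edges d ^^ k}"

text \<open>McShane's formula for the largest Lipschitz extension, with distance counted in flat
  edges.\<close>

definition flat_extension :: "real \<Rightarrow> 'a \<Rightarrow> real" where
  "flat_extension d z = Inf (path_costs d z)"

context
  fixes d :: real
  assumes f_zero: "\<And>z. z \<in> X - Y \<Longrightarrow> f z = 0" and d: "d > 0"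
begin

private lemma f_zero': "z \<in> finite_states \<Longrightarrow> z \<notin> Y \<Longrightarrow> f z = 0"
  using f_zero by (simp add: finite_states_def)

private lemma flat_edge:
  assumes "(p, q) \<in> flat_edges d"
  shows "(p, q) \<in> E" "p \<in> finite_states" "p \<notin> Y" "slope p \<le> d" "p \<notin> steep_states d" "q \<in> finite_states"
proof -
  show *: "(p, q) \<in> E" "p \<in> finite_states" "p \<notin> Y" "slope p \<le> d" "p \<notin> steep_states d"
    using assms by (auto simp: flat_edges_def steep_states_def)
  then show "q \<in> finite_states" using finite_neighbour by blast
qed

text \<open>A path to \<open>Y\<close> is followed up to its first steep state, which exists since
  terminal states are steep. So the infimum in \<open>flat_extension\<close> is over a nonempty
  set.\<close>

lemma flat_path_exists:
  assumes "z \<in> finite_states"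
  shows "\<exists>v k. v \<in> steep_states d \<and> (z, v) \<in> flat_edges d ^^ k"
proof -
  have "z \<in> X" using assms by (simp add: finite_states_def)
  then obtain y where y: "y \<in> Y" "(z, y) \<in> E\<^sup>*" by (rule path_to_terminal)
  from y(2) assms show ?thesis
  proof (induction rule: converse_rtrancl_induct)
    case base
    then have "y \<in> steep_states d" using y by (simp add: steep_states_def)
    then show ?case by (intro exI[of _ y] exI[of _ 0]) simp
  next
    case (step p q)
    show ?case
    proof (cases "p \<in> steep_states d")
      case True
      then show ?thesis by (intro exI[of _ p] exI[of _ 0]) simp
    next
      case False
      then have "p \<notin> Y" using step by (simp add: steep_states_def)
      then have "q \<in> finite_states" using finite_neighbour step by blast
      then obtain v k where v: "v \<in> steep_states d" "(q, v) \<in> flat_edges d ^^ k" using step by blast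
      have "(p, q) \<in> flat_edges d" using step False by (simp add: flat_edges_def)
      then have "(p, v) \<in> flat_edges d ^^ Suc k" using v(2) by (rule relpow_Suc_I2)
      with v(1) show ?thesis by blast
    qed
  qed
qed

private lemma path_costs_nonempty: "z \<in> finite_states \<Longrightarrow> path_costs d z \<noteq> {}"
  using flat_path_exists unfolding path_costs_def by blast

private lemma path_costs_bdd_below: "bdd_below (path_costs d z)"
  using d real_value_nonneg by (intro bdd_belowI[of _ 0]) (auto simp: path_costs_def)

lemma flat_extension_le:
  "v \<in> steep_states d \<Longrightarrow> (z, v) \<in> flat_edges d ^^ k \<Longrightarrow> flat_extension d z \<le> real_value v + d * real k"
  unfolding flat_extension_def
  by (intro cInf_lower path_costs_bdd_below) (auto simp: path_costs_def)

private lemma flat_extension_greatest: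
  assumes "z \<in> finite_states"
    and "\<And>v k. v \<in> steep_states d \<Longrightarrow> (z, v) \<in> flat_edges d ^^ k \<Longrightarrow> t \<le> real_value v + d * real k"
  shows "t \<le> flat_extension d z"
  unfolding flat_extension_def using assms
  by (intro cInf_greatest path_costs_nonempty) (auto simp: path_costs_def)

private lemma flat_extension_approx:
  assumes "z \<in> finite_states" "e > 0"
  obtains v k where "v \<in> steep_states d" "(z, v) \<in> flat_edges d ^^ k"
    "real_value v + d * real k < flat_extension d z + e"
proof -
  have "Inf (path_costs d z) < flat_extension d z + e" using assms by (simp add: flat_extension_def)
  then obtain t where "t \<in> path_costs d z" "t < flat_extension d z + e"
    using cInf_lessD[OF path_costs_nonempty[OF assms(1)]] by blast
  then show thesis using that by (auto simp: path_costs_def)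
qed

private lemma steep_path_trivial:
  assumes "z \<in> steep_states d" "(z, v) \<in> flat_edges d ^^ k"
  shows "k = 0 \<and> v = z"
proof (cases k)
  case (Suc n)
  then obtain q where "(z, q) \<in> flat_edges d" using assms(2) by (metis relpow_Suc_D2)
  then show ?thesis using assms(1) flat_edge(5) by blast
qed (use assms in auto)

lemma flat_extension_steep:
  assumes "z \<in> steep_states d" shows "flat_extension d z = real_value z"
proof (rule antisym)
  show "flat_extension d z \<le> real_value z"
    using flat_extension_le[of z z 0] assms by simp
  show "real_value z \<le> flat_extension d z"
    using assms by (intro flat_extension_greatest) (auto simp: steep_states_def dest: steep_path_trivial[OF assms])
qed

text \<open>Along a flat edge the value falls by at most the slope, hence by at most
  \<open>d\<close>, so each path cost dominates the value.\<close>

private lemma real_value_le_flat_extension: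
  assumes "z \<in> finite_states" shows "real_value z \<le> flat_extension d z"
proof -
  have path: "real_value z \<le> real_value v + d * real k" if "(z, v) \<in> flat_edges d ^^ k" for z v k
    using that
  proof (induction k arbitrary: z)
    case (Suc k)
    obtain q where q: "(z, q) \<in> flat_edges d" "(q, v) \<in> flat_edges d ^^ k"
      using Suc.prems by (metis relpow_Suc_D2)
    have "real_value z \<le> real_value q + slope z"
      using slope_lower[of z q] flat_edge[OF q(1)] f_zero'[of z] by simp
    then show ?case using Suc.IH[OF q(2)] flat_edge(4)[OF q(1)] by (simp add: algebra_simps)
  qed simp
  show ?thesis by (rule flat_extension_greatest[OF assms path])
qed

private lemma flat_extension_edge:
  assumes "(p, q) \<in> flat_edges d" shows "flat_extension d p \<le> flat_extension d q + d"
proof -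
  have "flat_extension d p - d \<le> flat_extension d q"
  proof (rule flat_extension_greatest[OF flat_edge(6)[OF assms]])
    fix v k assume v: "v \<in> steep_states d" "(q, v) \<in> flat_edges d ^^ k"
    have "(p, v) \<in> flat_edges d ^^ Suc k" using assms v(2) by (rule relpow_Suc_I2)
    from flat_extension_le[OF v(1) this] show "flat_extension d p - d \<le> real_value v + d * real k"
      by (simp add: algebra_simps)
  qed
  then show ?thesis by simp
qed

text \<open>The reversed edge leaves the flat state \<open>y\<close>, so reaching the steep set from
  \<open>y\<close> costs at most one edge more than from \<open>z\<close>; this again uses that
  \<open>E\<close> is undirected.\<close>

private lemma flat_extension_neighbour_flat:
  assumes "z \<in> finite_states" "z \<notin> Y" "(z, y) \<in> E" "y \<notin> steep_states d"
  shows "flat_extension d y \<le> flat_extension d z + d"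
proof (rule flat_extension_edge)
  show "(y, z) \<in> flat_edges d"
    using assms finite_neighbour[OF assms(1-3)] undirected by (auto simp: flat_edges_def dest: symD)
qed

text \<open>At a steep neighbour the extension equals the value, while at \<open>z\<close> it is at
  least the value, so the upper slope bound carries over. At a flat neighbour it rises by at most
  \<open>d\<close>.\<close>

private lemma flat_extension_upper:
  assumes z: "z \<in> finite_states" "z \<notin> Y" and y: "(z, y) \<in> E"
  shows "flat_extension d y \<le> flat_extension d z + max (slope z) d"
proof (cases "y \<in> steep_states d")
  case False
  then show ?thesis using flat_extension_neighbour_flat[OF z y] by simp
next
  case True
  have "flat_extension d y = real_value y" by (rule flat_extension_steep[OF True])
  also have "\<dots> \<le> real_value z + slope z" using slope_upper[OF z y] f_zero'[OF z] by simp
  also have "\<dots> \<le> flat_extension d z + max (slope z) d"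
    using real_value_le_flat_extension[OF z(1)] by simp
  finally show ?thesis .
qed

text \<open>From a steep state an almost greedy move leads to a steep state, where extension and
  value agree. From a flat state the first edge of an almost optimal path lowers the extension by
  \<open>d\<close>, up to \<open>e\<close>.\<close>

private lemma flat_extension_lower:
  assumes z: "z \<in> finite_states" "z \<notin> Y" and e: "e > 0"
  shows "\<exists>y. (z, y) \<in> E \<and> flat_extension d y \<le> flat_extension d z - max (slope z) d + e"
proof (cases "z \<in> steep_states d")
  case True
  then have sz: "d < slope z" using z by (simp add: steep_states_def)
  \<comment> \<open>For nonterminal \<open>y\<close> the edge back to \<open>z\<close> gives that
    \<open>slope y\<close> is at least \<open>slope z - e'\<close>; this choice keeps it above
    \<open>d\<close>.\<close>
  define e' where "e' = min e ((slope z - d) / 2)"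
  have e': "0 < e'" "e' \<le> e" "e' < slope z - d"
    using e sz by (auto simp: e'_def min_def)
  obtain y where y: "(z, y) \<in> E" "real_value y \<le> real_value z - slope z + e'"
    using slope_approx[OF z e'(1)] f_zero'[OF z] by auto
  have yf: "y \<in> finite_states" by (rule finite_neighbour[OF z y(1)])
  have "y \<in> steep_states d"
  proof (cases "y \<in> Y")
    case False
    have "(y, z) \<in> E" using y(1) undirected by (auto dest: symD)
    then have "real_value z \<le> real_value y + slope y"
      using slope_upper[OF yf False, of z] f_zero'[OF yf False] by simp
    then show ?thesis using y(2) e'(3) yf by (simp add: steep_states_def)
  qed (use yf in \<open>simp add: steep_states_def\<close>)
  then show ?thesis
    using y e'(2) sz True by (intro exI[of _ y]) (simp add: flat_extension_steep)
next
  case False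
  then have sz: "slope z \<le> d" using z by (simp add: steep_states_def)
  obtain v k where v: "v \<in> steep_states d" "(z, v) \<in> flat_edges d ^^ k"
    "real_value v + d * real k < flat_extension d z + e"
    using flat_extension_approx[OF z(1) e] by blast
  obtain n where n: "k = Suc n" using v False by (cases k) auto
  then obtain q where q: "(z, q) \<in> flat_edges d" "(q, v) \<in> flat_edges d ^^ n"
    using v(2) by (metis relpow_Suc_D2)
  have "flat_extension d q \<le> real_value v + d * real n" by (rule flat_extension_le[OF v(1) q(2)])
  then have "flat_extension d q \<le> flat_extension d z - max (slope z) d + e"
    using v(3) n sz by (simp add: algebra_simps)
  with flat_edge(1)[OF q(1)] show ?thesis by blast
qed

lemma flat_extension_supersolution: "supersolution (flat_extension d) (\<lambda>z. max (slope z) d)"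
  unfolding supersolution_def
proof (intro conjI ballI allI impI)
  fix z assume "z \<in> finite_states"
  then show "0 \<le> flat_extension d z"
    using real_value_le_flat_extension real_value_nonneg order_trans by metis
next
  fix y assume "y \<in> Y"
  then show "flat_extension d y = F y + b"
    using terminal_finite by (simp add: flat_extension_steep steep_states_def real_value_terminal)
next
  fix z y assume z: "z \<in> finite_states - Y" and y: "(z, y) \<in> E"
  then show "flat_extension d y + f z \<le> flat_extension d z + max (slope z) d"
    using flat_extension_upper[of z y] f_zero'[of z] by simp
next
  fix z and e :: real assume z: "z \<in> finite_states - Y" and e: "e > 0"
  then show "\<exists>y. (z, y) \<in> E \<and> flat_extension d y + f z \<le> flat_extension d z - max (slope z) d + e"
    using flat_extension_lower[of z e] f_zero'[of z] by simp
qed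

end

text \<open>
  On the way to the first state with nonzero slope the value is constant, so the path to it costs
  at most \<open>d k\<close>, which vanishes with \<open>d\<close>.
\<close>

lemma flat_extension_limit:
  assumes f_zero: "\<And>z. z \<in> X - Y \<Longrightarrow> f z = 0" and x: "x \<in> finite_states" and e: "e > 0"
  obtains d where "d > 0" "flat_extension d x \<le> real_value x + e"
proof -
  have "x \<in> X" using x by (simp add: finite_states_def)
  then obtain y where y: "y \<in> Y" "(x, y) \<in> E\<^sup>*" by (rule path_to_terminal)
  \<comment> \<open>The exit \<open>v\<close> and the length \<open>k\<close> are the same for all
    small \<open>d\<close>, so \<open>d * k\<close> tends to 0.\<close>
  from y(2) x have "\<exists>v k d0. d0 > 0 \<and> real_value v = real_value x \<and>
      (\<forall>d. 0 < d \<and> d < d0 \<longrightarrow> v \<in> steep_states d \<and> (x, v) \<in> flat_edges d ^^ k)"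
  proof (induction rule: converse_rtrancl_induct)
    case base
    then show ?case
      using y(1) by (intro exI[of _ y] exI[of _ 0] exI[of _ 1]) (simp add: steep_states_def)
  next
    case (step p q)
    show ?case
    proof (cases "p \<in> Y \<or> slope p > 0")
      \<comment> \<open>A terminal state is steep for every \<open>d\<close>, any other such state
        for every \<open>d\<close> below its slope.\<close>
      case True
      then show ?thesis
        using step.prems
        by (intro exI[of _ p] exI[of _ 0] exI[of _ "if slope p > 0 then slope p else 1"])
          (auto simp: steep_states_def)
    next
      case False
      then have p: "p \<in> finite_states" "p \<notin> Y" "slope p \<le> 0" using step.prems by auto
      have fp: "f p = 0" using f_zero p by (simp add: finite_states_def)
      have q: "q \<in> finite_states" using finite_neighbour p step by blast
      have "real_value q = real_value p"
        using slope_upper[OF p(1,2) step.hyps(1)] slope_lower[OF p(1,2) step.hyps(1)] p(3) fp by simp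
      moreover obtain v k d0 where "d0 > 0" "real_value v = real_value q"
        and v: "\<And>d. 0 < d \<Longrightarrow> d < d0 \<Longrightarrow> v \<in> steep_states d \<and> (q, v) \<in> flat_edges d ^^ k"
        using step.IH[OF q] by blast
      moreover have "v \<in> steep_states d \<and> (p, v) \<in> flat_edges d ^^ Suc k" if "0 < d" "d < d0" for d
      proof -
        have "(p, q) \<in> flat_edges d"
          using p step.hyps(1) that by (simp add: flat_edges_def steep_states_def)
        then show ?thesis using v[OF that] relpow_Suc_I2 by metis
      qed
      ultimately show ?thesis by (intro exI[of _ v] exI[of _ "Suc k"] exI[of _ d0]) simp
    qed
  qed
  then obtain v k d0 where d0: "d0 > 0" "real_value v = real_value x"
    and v: "\<And>d. 0 < d \<Longrightarrow> d < d0 \<Longrightarrow> v \<in> steep_states d \<and> (x, v) \<in> flat_edges d ^^ k"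
    by blast
  define d where "d = min (d0 / 2) (e / (real k + 1))"
  have d: "0 < d" "d < d0" using d0(1) e by (auto simp: d_def)
  have "d * real k \<le> e / (real k + 1) * real k" unfolding d_def by (intro mult_right_mono) auto
  also have "\<dots> \<le> e" using e by (simp add: field_simps)
  finally have "d * real k \<le> e" .
  moreover have "flat_extension d x \<le> real_value v + d * real k"
    using flat_extension_le[OF f_zero d(1)] v[OF d] by blast
  ultimately show thesis using that[of d] d(1) d0(2) by simp
qed

text \<open>Half of \<open>e\<close> pays for replacing the value by its extension, half for the
  error terms. Since \<open>e' \<le> d\<close>, the step sizes stay at least \<open>d / 2\<close>,
  so the potential forces termination.\<close>

lemma zero_running_cost_upper:
  assumes f_zero: "\<And>z. z \<in> X - Y \<Longrightarrow> f z = 0" and x: "x \<in> finite_states" and e: "e > 0"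
  obtains s where "legal_choice s"
    and "\<And>S1. S1 \<in> random_strategies X E Y \<Longrightarrow>
      terminal_integral Y S1 (pure_strategy s) (\<lambda>_. 1) (x, []) = 1 \<and>
      terminal_integral Y S1 (pure_strategy s) shifted_payoff (x, []) \<le> shifted_value x + ennreal e"
proof -
  obtain d where d: "d > 0" "flat_extension d x \<le> real_value x + e / 2"
    using flat_extension_limit[OF f_zero x, of "e / 2"] e by auto
  define e' where "e' = min (e / 2) d"
  have e': "e' > 0" "e' \<le> e / 2" "e' \<le> d" using e d(1) by (auto simp: e'_def)
  show thesis
  proof (rule supersolution_strategy[OF flat_extension_supersolution[OF f_zero d(1)] e'(1)])
    fix s assume legal: "legal_choice s"
      and within: "\<And>S1. S1 \<in> random_strategies X E Y \<Longrightarrow> steps_within Y S1 (pure_strategy s) finite_plays"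
      and controlled: "\<And>S1. S1 \<in> random_strategies X E Y \<Longrightarrow>
        controlled Y S1 (pure_strategy s) finite_plays (play_potential (flat_extension d) e')
          (\<lambda>h. max (slope (current h)) d - e' / 2 ^ Suc (length (snd h)))"
      and payoff: "\<And>S1 x. S1 \<in> random_strategies X E Y \<Longrightarrow> x \<in> finite_states \<Longrightarrow>
        terminal_integral Y S1 (pure_strategy s) shifted_payoff (x, []) \<le> ennreal (flat_extension d x + e')"
    have start: "(x, []) \<in> finite_plays"
      using x by (auto simp: finite_plays_def finite_states_def intro: legal_plays.start)
    show thesis
    proof (rule that[OF legal], intro conjI)
      fix S1 assume S1: "S1 \<in> random_strategies X E Y"
      show "terminal_integral Y S1 (pure_strategy s) (\<lambda>_. 1) (x, []) = 1"
      proof (rule controlled_terminates[OF within[OF S1] controlled[OF S1] _ _ start])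
        show "0 < d / 2" using d(1) by simp
        fix h :: "'a play"
        have "e' / 2 ^ Suc (length (snd h)) \<le> e' / 2 ^ 1"
          using e'(1) by (intro divide_left_mono power_increasing) auto
        then show "d / 2 \<le> max (slope (current h)) d - e' / 2 ^ Suc (length (snd h))"
          using e'(3) by simp
      qed
      have "terminal_integral Y S1 (pure_strategy s) shifted_payoff (x, []) \<le> ennreal (flat_extension d x + e')"
        by (rule payoff[OF S1 x])
      also have "\<dots> \<le> ennreal (real_value x + e)" using d(2) e'(2) by (intro ennreal_leI) simp
      finally show "terminal_integral Y S1 (pure_strategy s) shifted_payoff (x, []) \<le> shifted_value x + ennreal e"
        using e by (simp add: ennreal_real_value[OF x, symmetric] real_value_nonneg flip: ennreal_plus)
    qed
  qed
qed

section \<open>The value of the game\<close>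

context
  fixes S1 S2 x
  assumes S: "S1 \<in> random_strategies X E Y" "S2 \<in> random_strategies X E Y" and x: "x \<in> X"
begin

text \<open>Only legal plays have positive mass, and on these the payoff is at least
  \<open>- b\<close>; so the shift applies.\<close>

private lemma terminates_payoff:
  assumes "terminal_integral Y S1 S2 (\<lambda>_. 1) (x, []) = 1"
  shows "payoff_defined Y F f x S1 S2"
    and "extended_expectation (completed_law Y S1 S2 x) (total_payoff F f) =
      enn2ereal (terminal_integral Y S1 S2 shifted_payoff (x, [])) - ereal b"
proof -
  let ?N = "completed_law Y S1 S2 x"
  have ae: "AE h in ?N. - b \<le> total_payoff F f h"
    unfolding completed_law_def
  proof (subst AE_density, simp, rule AE_I2, rule impI)
    fix h assume "h \<in> space (count_space {h. current h \<in> Y})"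
      and "0 < ennreal (pmf (play_pmf Y S1 S2 x (length (snd h))) h)"
    then have h: "current h \<in> Y" "h \<in> set_pmf (run Y S1 S2 (length (snd h)) (x, []))"
      by (auto simp: play_pmf_eq_run set_pmf_iff)
    have "h \<in> legal \<inter> UNIV"
      using run_within[OF steps_within_legal[OF S, of UNIV] _ h(2)] legal_plays.start[OF x] by simp
    then show "- b \<le> total_payoff F f h"
      using legal_accrued_nonneg[of h] F_ge[OF h(1)] by (simp add: total_payoff_accrued)
  qed
  have meas: "total_payoff F f \<in> borel_measurable ?N"
    by (simp add: completed_law_def)
  have ends: "terminates_almost_surely Y S1 S2 x"
    using assms by (simp add: terminates_almost_surely_iff)
  note shift = extended_expectation_shift[OF ends[unfolded terminates_almost_surely_def] meas ae b_nonneg]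
  show "payoff_defined Y F f x S1 S2"
    using ends shift(1) by (simp add: payoff_defined_def)
  show "extended_expectation ?N (total_payoff F f) =
      enn2ereal (terminal_integral Y S1 S2 shifted_payoff (x, [])) - ereal b"
    unfolding shift(2) nn_integral_completed_law shifted_payoff_def ..
qed

lemma F_minus_ge:
  assumes "terminal_integral Y S1 S2 (\<lambda>_. 1) (x, []) = 1"
    and "t \<le> terminal_integral Y S1 S2 shifted_payoff (x, [])"
  shows "enn2ereal t - ereal b \<le> F_minus Y F f x S1 S2"
  using assms(2) terminates_payoff[OF assms(1)]
  by (simp add: F_minus_def ereal_minus_mono less_eq_ennreal.rep_eq)

lemma F_plus_le:
  assumes "terminal_integral Y S1 S2 (\<lambda>_. 1) (x, []) = 1"
    and "terminal_integral Y S1 S2 shifted_payoff (x, []) \<le> t"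
  shows "F_plus Y F f x S1 S2 \<le> enn2ereal t - ereal b"
  using assms(2) terminates_payoff[OF assms(1)]
  by (simp add: F_plus_def ereal_minus_mono less_eq_ennreal.rep_eq)

end

text \<open>The strategies found for player I are deterministic and work against all random ones, so
  any strategy class between the two will do.\<close>

lemma value_I_ge:
  assumes x: "x \<in> X"
    and \<Sigma>: "deterministic_strategies X E Y \<subseteq> \<Sigma>" "\<Sigma> \<subseteq> random_strategies X E Y"
  shows "enn2ereal (shifted_value x) - ereal b \<le> value_I \<Sigma> Y F f x"
proof -
  have below: "enn2ereal t \<le> value_I \<Sigma> Y F f x + ereal b" if t: "t < shifted_value x \<or> t = 0" for t
  proof -
    have "(x, []) \<in> legal" using x by (rule legal_plays.start)
    then obtain s where s: "legal_choice s"
      and S2: "\<And>S2. S2 \<in> random_strategies X E Y \<Longrightarrow>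
        terminal_integral Y (pure_strategy s) S2 (\<lambda>_. 1) (x, []) = 1 \<and>
        t \<le> terminal_integral Y (pure_strategy s) S2 shifted_payoff (x, [])"
      using guaranteed_below_shifted_value[OF x t] unfolding guaranteed_def by fastforce
    have "enn2ereal t - ereal b \<le> (INF S2\<in>\<Sigma>. F_minus Y F f x (pure_strategy s) S2)"
      using S2 \<Sigma>(2) by (intro INF_greatest F_minus_ge[OF legal_choice_random[OF s] _ x]) auto
    also have "\<dots> \<le> value_I \<Sigma> Y F f x"
      unfolding value_I_def using legal_choice_deterministic[OF s] \<Sigma>(1) by (intro SUP_upper) auto
    finally show ?thesis by (simp add: ereal_minus_le)
  qed
  \<comment> \<open>The case \<open>t = 0\<close> yields nonnegativity, which allows the value plus
    \<open>b\<close> to be viewed as an \<open>ennreal\<close>, where density of the order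
    applies.\<close>
  have "0 \<le> value_I \<Sigma> Y F f x + ereal b" using below[of 0] by (simp add: zero_ennreal.rep_eq)
  then have e2: "enn2ereal (e2ennreal (value_I \<Sigma> Y F f x + ereal b)) = value_I \<Sigma> Y F f x + ereal b"
    by (rule enn2ereal_e2ennreal)
  have "shifted_value x \<le> e2ennreal (value_I \<Sigma> Y F f x + ereal b)"
    by (rule dense_le) (use below e2 in \<open>simp add: less_eq_ennreal.rep_eq\<close>)
  then have "enn2ereal (shifted_value x) \<le> value_I \<Sigma> Y F f x + ereal b"
    by (simp add: less_eq_ennreal.rep_eq e2)
  then show ?thesis by (simp add: ereal_minus_le)
qed

text \<open>One of the two termination arguments gives player II a deterministic strategy with loss
  at most \<open>e\<close>, for any \<open>e > 0\<close>; for an infinite value the bound is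
  trivial.\<close>

lemma value_II_le:
  assumes running: "(\<forall>z\<in>X - Y. f z = 0) \<or> (\<exists>c>0. \<forall>z\<in>X - Y. c \<le> f z)"
    and x: "x \<in> X"
    and \<Sigma>: "deterministic_strategies X E Y \<subseteq> \<Sigma>" "\<Sigma> \<subseteq> random_strategies X E Y"
  shows "value_II \<Sigma> Y F f x \<le> enn2ereal (shifted_value x) - ereal b"
proof (cases "shifted_value x = top")
  case True
  then show ?thesis by simp
next
  case False
  then have fin: "x \<in> finite_states" using x by (simp add: finite_states_def less_top)
  have above: "value_II \<Sigma> Y F f x \<le> enn2ereal (shifted_value x + ennreal e) - ereal b" if e: "e > 0" for e
  proof -
    obtain s where s: "legal_choice s"
      and S1: "\<And>S1. S1 \<in> random_strategies X E Y \<Longrightarrow>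
        terminal_integral Y S1 (pure_strategy s) (\<lambda>_. 1) (x, []) = 1 \<and>
        terminal_integral Y S1 (pure_strategy s) shifted_payoff (x, []) \<le> shifted_value x + ennreal e"
      using running positive_running_cost_upper[OF _ _ fin e] zero_running_cost_upper[OF _ fin e] by metis
    have "value_II \<Sigma> Y F f x \<le> (SUP S1\<in>\<Sigma>. F_plus Y F f x S1 (pure_strategy s))"
      unfolding value_II_def using legal_choice_deterministic[OF s] \<Sigma>(1) by (intro INF_lower) auto
    also have "\<dots> \<le> enn2ereal (shifted_value x + ennreal e) - ereal b"
      using S1 \<Sigma>(2) by (intro SUP_least F_plus_le[OF _ legal_choice_random[OF s] x]) auto
    finally show ?thesis .
  qed
  obtain r where r: "shifted_value x = ennreal r" "r \<ge> 0" using False by (cases "shifted_value x") auto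
  show ?thesis
  proof (rule ereal_le_epsilon2)
    fix e :: real assume "e > 0"
    from above[OF this] this r show "value_II \<Sigma> Y F f x \<le> enn2ereal (shifted_value x) - ereal b + ereal e"
      by (simp add: algebra_simps flip: ennreal_plus)
  qed
qed

lemma value_I_le_value_II: "value_I \<Sigma> Y F f x \<le> value_II \<Sigma> Y F f x"
  unfolding value_I_def value_II_def
proof (intro SUP_least INF_greatest)
  fix S1 S2 assume S: "S1 \<in> \<Sigma>" "S2 \<in> \<Sigma>"
  have "(INF S2\<in>\<Sigma>. F_minus Y F f x S1 S2) \<le> F_minus Y F f x S1 S2" using S by (intro INF_lower)
  also have "\<dots> \<le> F_plus Y F f x S1 S2" by (simp add: F_minus_def F_plus_def)
  also have "\<dots> \<le> (SUP S1\<in>\<Sigma>. F_plus Y F f x S1 S2)" using S by (intro SUP_upper)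
  finally show "(INF S2\<in>\<Sigma>. F_minus Y F f x S1 S2) \<le> (SUP S1\<in>\<Sigma>. F_plus Y F f x S1 S2)" .
qed

lemma value_I_eq_value_II:
  assumes "(\<forall>z\<in>X - Y. f z = 0) \<or> (\<exists>c>0. \<forall>z\<in>X - Y. c \<le> f z)" and "x \<in> X"
    and "deterministic_strategies X E Y \<subseteq> \<Sigma>" "\<Sigma> \<subseteq> random_strategies X E Y"
  shows "value_I \<Sigma> Y F f x = value_II \<Sigma> Y F f x"
  using value_I_le_value_II value_II_le[OF assms] value_I_ge[OF assms(2-4)]
  by (meson antisym order_trans)

end

theorem theorem1p2:
  fixes X Y :: "'a set" and E :: "('a \<times> 'a) set" and F f :: "'a \<Rightarrow> real"
  assumes edges: "E \<subseteq> X \<times> X"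
    and terminal: "Y \<noteq> {}" "Y \<subseteq> X"
    and connected: "connected_graph X E"
    and running: "(\<forall>x\<in>X - Y. f x = 0) \<or> (INF x\<in>X - Y. ereal (f x)) > 0"
    and bounded_below: "(INF y\<in>Y. ereal (F y)) > - \<infinity>"
    and undirected: "sym E"
  shows "\<forall>x\<in>X.
      value_I (deterministic_strategies X E Y) Y F f x
        = value_II (deterministic_strategies X E Y) Y F f x
    \<and> value_I (random_strategies X E Y) Y F f x
        = value_II (random_strategies X E Y) Y F f x"
proof -
  \<comment> \<open>A real number below the infimum; its absolute value serves as the shift because
    \<open>b\<close> has to be nonnegative.\<close>
  obtain m where m: "ereal m < (INF y\<in>Y. ereal (F y))"
    using bounded_below ereal_dense2 by blast
  have F_ge: "- \<bar>m\<bar> \<le> F y" if "y \<in> Y" for y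
    using less_INF_D[OF m that] by simp
  have running': "(\<forall>z\<in>X - Y. f z = 0) \<or> (\<exists>c>0. \<forall>z\<in>X - Y. c \<le> f z)"
    using running
  proof
    assume "0 < (INF x\<in>X - Y. ereal (f x))"
    \<comment> \<open>The infimum is infinite if \<open>X = Y\<close>, so a real \<open>c\<close> is
      taken strictly between 0 and it.\<close>
    then obtain c where c: "0 < ereal c" "ereal c < (INF x\<in>X - Y. ereal (f x))"
      using ereal_dense2 by blast
    have "c \<le> f z" if "z \<in> X - Y" for z
      using less_INF_D[OF c(2) that] by simp
    then show ?thesis using c(1) by auto
  qed simp
  then have f_nonneg: "0 \<le> f z" if "z \<in> X - Y" for z
    using that by (metis order.refl less_imp_le order_trans)
  interpret tug_of_war X Y E F f "\<bar>m\<bar>"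
    using edges terminal connected undirected f_nonneg F_ge by unfold_locales auto
  show ?thesis
    using value_I_eq_value_II[OF running'] deterministic_subset_random by blast
qed

end
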